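(* Let $K$ be an infinite field, $n$ a positive integer, and let $G$ be the subgroup of $\mathrm{GL}_n(K)$ consisting of the upper triangular matrices. Let $A=K^n$ (as an abelian group) and let $G\overset{\alpha}{\curvearrowright}A$ be the natural action by matrix multiplication. Then $h_{alg}(\alpha)=0$.
   Context: $G$ is regarded as a discrete group; it is solvable, hence amenable. A right Følner net of an amenable group $G$ is a net $(F_i)_{i\in I}$ of non-empty finite subsets of $G$ with $\lim_{i\in I}|F_ig\setminus F_i|/|F_i|=0$ for every $g\in G$. For a left action $\alpha$ of $G$ on an abelian group $A$ by automorphisms, non-empty finite $X\subseteq A$ and non-empty finite $F\subseteq G$ put $T_F(\alpha,X)=\sum_{g\in F}\alpha(g)(X)$ (sum of subsets). Set $H_{alg}(\alpha,X)=\lim_{i\in I}\frac{\log|T_{F_i}(\alpha,X)|}{|F_i|}$ for any right Følner net $(F_i)_{i\in I}$ of $G$; the limit is known to exist, to be finite, and not to depend on the net. Define $h_{alg}(\alpha)=\sup\{H_{alg}(\alpha,X):X\subseteq A\text{ non-empty finite}\}\in[0,\infty]$. *)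

theory Defs
  imports
    "HOL-Analysis.Analysis"
    "HOL-Algebra.Bij"
    "HOL-Algebra.Coset"
    "Jordan_Normal_Form.Matrix"
    "Jordan_Normal_Form.Determinant"
begin

text \<open>
  A net is rendered as a family \<open>F\<close> together with a filter \<open>\<Phi>\<close> on the index type; for a net indexed
  by a directed set, \<open>\<Phi>\<close> is the proper filter generated by the tails.
\<close>

definition right_Folner_net ::
    "('g, 'x) monoid_scheme \<Rightarrow> ('i \<Rightarrow> 'g set) \<Rightarrow> 'i filter \<Rightarrow> bool" where
  "right_Folner_net G F \<Phi> \<longleftrightarrow>
     \<Phi> \<noteq> bot \<and>
     (\<forall>\<^sub>F i in \<Phi>. finite (F i) \<and> F i \<noteq> {} \<and> F i \<subseteq> carrier G) \<and>
     (\<forall>g\<in>carrier G.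
        ((\<lambda>i. real (card ((F i #>\<^bsub>G\<^esub> g) - F i)) / real (card (F i))) \<longlongrightarrow> 0) \<Phi>)"

text \<open>
  The abelian group \<open>A\<close> is a HOL-Algebra group, so \<open>finprod A\<close> is what is usually written as a
  finite sum in \<open>A\<close>; the set below is the sum of the subsets \<open>\<alpha> g ` X\<close>, \<open>g \<in> F\<close>.
\<close>

definition alg_trajectory ::
    "('a, 'c) monoid_scheme \<Rightarrow> ('g \<Rightarrow> 'a \<Rightarrow> 'a) \<Rightarrow> 'g set \<Rightarrow> 'a set \<Rightarrow> 'a set" where
  "alg_trajectory A \<alpha> F X = {finprod A y F | y. \<forall>g\<in>F. y g \<in> \<alpha> g ` X}"

text \<open>
  The common limit along all right Folner nets. A definition cannot quantify over index types, so
  the nets here are indexed by subsets of the group; the lemma after the definition shows that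
  this covers every index type. If \<open>G\<close> has no right Folner net, or if the limit does not
  exist or depends on the net, the value is unspecified.
\<close>

definition H_alg ::
    "('g, 'x) monoid_scheme \<Rightarrow> ('a, 'c) monoid_scheme \<Rightarrow> ('g \<Rightarrow> 'a \<Rightarrow> 'a) \<Rightarrow> 'a set \<Rightarrow> real" where
  "H_alg G A \<alpha> X = (THE h. \<forall>(F :: 'g set \<Rightarrow> 'g set) \<Phi>. right_Folner_net G F \<Phi> \<longrightarrow>
     ((\<lambda>i. ln (real (card (alg_trajectory A \<alpha> (F i) X))) / real (card (F i))) \<longlongrightarrow> h) \<Phi>)"

lemma right_Folner_net_index_type:
  fixes F :: "'i \<Rightarrow> 'g set" and f :: "'g set \<Rightarrow> real"
  assumes "\<And>(F' :: 'g set \<Rightarrow> 'g set) \<Psi>. right_Folner_net G F' \<Psi> \<Longrightarrow> ((\<lambda>E. f (F' E)) \<longlongrightarrow> h) \<Psi>"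
    and "right_Folner_net G F \<Phi>"
  shows "((\<lambda>i. f (F i)) \<longlongrightarrow> h) \<Phi>"
proof -
  have "right_Folner_net G (\<lambda>E. E) (filtermap F \<Phi>)"
    using assms(2)
    by (simp add: right_Folner_net_def eventually_filtermap filterlim_filtermap filtermap_bot_iff)
  from assms(1)[OF this] show ?thesis
    by (simp add: filterlim_filtermap)
qed

definition h_alg ::
    "('g, 'x) monoid_scheme \<Rightarrow> ('a, 'c) monoid_scheme \<Rightarrow> ('g \<Rightarrow> 'a \<Rightarrow> 'a) \<Rightarrow> ereal" where
  "h_alg G A \<alpha> = (SUP X \<in> {X. X \<noteq> {} \<and> finite X \<and> X \<subseteq> carrier A}. ereal (H_alg G A \<alpha> X))"

definition GL_group :: "'k::field itself \<Rightarrow> nat \<Rightarrow> 'k mat monoid" where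
  "GL_group ty n = units_of (ring_mat ty n ())"

definition upper_triangular_group :: "'k::field itself \<Rightarrow> nat \<Rightarrow> 'k mat monoid" where
  "upper_triangular_group ty n =
     (GL_group ty n)\<lparr>carrier := {M \<in> carrier (GL_group ty n). upper_triangular M}\<rparr>"

text \<open>Restricted to the carrier because \<open>AutoGroup\<close> consists of extensional functions.\<close>

definition natural_action :: "nat \<Rightarrow> 'k::field mat \<Rightarrow> 'k vec \<Rightarrow> 'k vec" where
  "natural_action n M = (\<lambda>v\<in>carrier_vec n. M *\<^sub>v v)"

lemma GL_group_simps:
  "carrier (GL_group ty n) = Units (ring_mat ty n ())"
  "mult (GL_group ty n) = (*)"
  "one (GL_group ty n) = 1\<^sub>m n"
  by (simp_all add: GL_group_def units_of_def ring_mat_def)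

lemma group_GL_group: "group (GL_group TYPE('k::field) n)"
proof -
  interpret ring "ring_mat TYPE('k) n ()" by (rule ring_mat)
  show ?thesis unfolding GL_group_def by (rule units_group)
qed

lemma inverse_upper_triangular:
  fixes M N :: "'k::field mat"
  assumes M: "M \<in> carrier_mat n n" and N: "N \<in> carrier_mat n n"
    and MN: "M * N = 1\<^sub>m n" and ut: "upper_triangular M"
  shows "upper_triangular N"
proof -
  have "det M * det N = 1"
    using det_mult[OF M N] MN by simp
  then have "det M \<noteq> 0" by auto
  then have diag: "M $$ (i,i) \<noteq> 0" if "i < n" for i
    using upper_triangular_imp_det_eq_0_iff[OF M ut] that M
    by (auto simp: diag_mat_def)
  have "N $$ (i,j) = 0" if "j < i" "i < n" for i j
    using that
  proof (induction "n - i" arbitrary: i rule: less_induct)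
    case less
    have "0 = (M * N) $$ (i,j)" using MN less.prems by simp
    also have "\<dots> = (\<Sum>k\<in>{0..<n}. M $$ (i,k) * N $$ (k,j))"
      using M N less.prems by (simp add: scalar_prod_def)
    also have "\<dots> = (\<Sum>k\<in>{i}. M $$ (i,k) * N $$ (k,j))"
    proof (rule sum.mono_neutral_right)
      show "\<forall>k\<in>{0..<n} - {i}. M $$ (i,k) * N $$ (k,j) = 0"
      proof
        fix k assume k: "k \<in> {0..<n} - {i}"
        then consider "k < i" | "i < k" by force
        then show "M $$ (i,k) * N $$ (k,j) = 0"
        proof cases
          case 1
          then show ?thesis using upper_triangularD[OF ut 1] M less.prems by simp
        next
          case 2
          then have "N $$ (k,j) = 0" using less.hyps[of k] less.prems k by simp
          then show ?thesis by simp
        qed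
      qed
    qed (use less.prems in auto)
    finally show ?case using diag[OF less.prems(2)] by simp
  qed
  then show ?thesis using N by (intro upper_triangularI) simp
qed

lemma subgroup_upper_triangular:
  "subgroup (carrier (upper_triangular_group TYPE('k::field) n)) (GL_group TYPE('k) n)"
proof -
  let ?R = "ring_mat TYPE('k) n ()"
  interpret ring ?R by (rule ring_mat)
  interpret GL: group "GL_group TYPE('k) n" by (rule group_GL_group)
  note [simp] = upper_triangular_group_def GL_group_simps
  have carr: "M \<in> carrier_mat n n" if "M \<in> Units ?R" for M
    using that by (auto simp: Units_def ring_mat_def)
  show ?thesis
  proof (rule GL.subgroupI)
    show "carrier (upper_triangular_group TYPE('k) n) \<subseteq> carrier (GL_group TYPE('k) n)" by auto
    have "1\<^sub>m n \<in> carrier (upper_triangular_group TYPE('k) n)"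
      using GL.one_closed by simp
    then show "carrier (upper_triangular_group TYPE('k) n) \<noteq> {}" by blast
  next
    fix M assume "M \<in> carrier (upper_triangular_group TYPE('k) n)"
    then have M: "M \<in> carrier (GL_group TYPE('k) n)" "upper_triangular M" by simp_all
    let ?N = "inv\<^bsub>GL_group TYPE('k) n\<^esub> M"
    have "M \<in> carrier_mat n n" "?N \<in> carrier_mat n n" "M * ?N = 1\<^sub>m n"
      using M(1) GL.inv_closed[OF M(1)] GL.r_inv[OF M(1)] by (simp_all add: carr)
    then have "upper_triangular ?N"
      using M(2) by (rule inverse_upper_triangular)
    then show "inv\<^bsub>GL_group TYPE('k) n\<^esub> M \<in> carrier (upper_triangular_group TYPE('k) n)"
      using GL.inv_closed[OF M(1)] by simp
  next
    fix M N
    assume "M \<in> carrier (upper_triangular_group TYPE('k) n)"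
      "N \<in> carrier (upper_triangular_group TYPE('k) n)"
    then have MN: "M \<in> carrier (GL_group TYPE('k) n)" "upper_triangular M"
      "N \<in> carrier (GL_group TYPE('k) n)" "upper_triangular N" by simp_all
    have c: "M \<in> carrier_mat n n" "N \<in> carrier_mat n n" using MN by (simp_all add: carr)
    have "upper_triangular (M * N)"
    proof (rule upper_triangularI)
      fix i j assume ij: "j < i" "i < dim_row (M * N)"
      have "M $$ (i,k) * N $$ (k,j) = 0" if "k < n" for k
      proof (cases "k < i")
        case True
        then show ?thesis using upper_triangularD[OF MN(2) True] c ij by simp
      next
        case False
        then show ?thesis using upper_triangularD[OF MN(4), of j k] c ij that by simp
      qed
      then show "(M * N) $$ (i,j) = 0"
        using c ij by (auto simp: scalar_prod_def intro!: sum.neutral)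
    qed
    then show "M \<otimes>\<^bsub>GL_group TYPE('k) n\<^esub> N \<in> carrier (upper_triangular_group TYPE('k) n)"
      using GL.m_closed[OF MN(1,3)] by simp
  qed
qed

lemma natural_action_by_automorphisms:
  "natural_action n \<in>
     hom (upper_triangular_group TYPE('k::field) n) (AutoGroup (monoid_vec TYPE('k) n))"
proof -
  let ?R = "ring_mat TYPE('k) n ()"
  have carr: "M \<in> carrier_mat n n" if "M \<in> Units ?R" for M
    using that by (auto simp: Units_def ring_mat_def)
  have bij: "bij_betw (natural_action n M) (carrier_vec n) (carrier_vec n)" if M: "M \<in> Units ?R" for M
  proof -
    obtain N where N: "N \<in> carrier_mat n n" "M * N = 1\<^sub>m n" "N * M = 1\<^sub>m n"
      using M by (auto simp: Units_def ring_mat_def)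
    show ?thesis
      by (rule bij_betw_byWitness[where f' = "\<lambda>v. N *\<^sub>v v"])
        (use N carr[OF M] in \<open>auto simp: natural_action_def assoc_mult_mat_vec[symmetric]\<close>)
  qed
  have aut: "natural_action n M \<in> auto (monoid_vec TYPE('k) n)" if M: "M \<in> Units ?R" for M
    using bij[OF M] carr[OF M]
    by (auto simp: auto_def Bij_def hom_def monoid_vec_simps natural_action_def
        mult_add_distrib_mat_vec)
  show ?thesis
  proof (rule homI)
    fix M :: "'k mat" assume "M \<in> carrier (upper_triangular_group TYPE('k) n)"
    then show "natural_action n M \<in> carrier (AutoGroup (monoid_vec TYPE('k) n))"
      by (auto simp: upper_triangular_group_def GL_group_simps AutoGroup_def intro: aut)
  next
    fix M N :: "'k mat"
    assume "M \<in> carrier (upper_triangular_group TYPE('k) n)"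
      "N \<in> carrier (upper_triangular_group TYPE('k) n)"
    then have MN: "M \<in> Units ?R" "N \<in> Units ?R"
      by (auto simp: upper_triangular_group_def GL_group_simps)
    then have "natural_action n M \<in> Bij (carrier_vec n)" "natural_action n N \<in> Bij (carrier_vec n)"
      using aut by (auto simp: auto_def monoid_vec_simps)
    then show "natural_action n (M \<otimes>\<^bsub>upper_triangular_group TYPE('k) n\<^esub> N) =
        natural_action n M \<otimes>\<^bsub>AutoGroup (monoid_vec TYPE('k) n)\<^esub> natural_action n N"
      using MN[THEN carr]
      by (auto simp: upper_triangular_group_def GL_group_simps AutoGroup_def BijGroup_def
          monoid_vec_simps natural_action_def compose_def fun_eq_iff)
  qed
qed

end

theory Submission
  imports Defs "HOL-Number_Theory.Cong" "HOL-Real_Asymp.Real_Asymp"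
begin

text \<open>
  The group contains the scalar matrices. A finite set \<open>E\<close> of group elements whose left translates
  partition the group bounds the entropy by \<open>log |T\<^sub>E(X)| / |E|\<close>: a Folner set is, up to boundary
  tiles, a disjoint union of translates of \<open>E\<close>, and \<open>log |T|\<close> is subadditive and translation
  invariant. For a set \<open>E\<close> of scalars, \<open>|T\<^sub>E(X)|\<close> is at most the \<open>|X|\<close>-th power of the number of
  subset sums of \<open>E\<close>, so it suffices to find tiles of scalars with few subset sums. In
  characteristic 0 these are \<open>{2\<^sup>i3\<^sup>j | i, j < L}\<close>; in characteristic \<open>p\<close>, if there is \<open>t\<close> of infinite
  order, \<open>{t\<^sup>i(1+t)\<^sup>j | i, j < L}\<close>; otherwise the unit groups of large finite subfields. Since
  the entropy is defined through all Folner nets, amenability is also needed; it follows from the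
  filtration of the upper triangular group with abelian quotients.
\<close>

subsection \<open>Amenability\<close>

text \<open>A tile \<open>E\<close> of scalars is in general nowhere near a Folner set of the whole
  group; only the tiling property carries its bound over, and a tiling of a subgroup spreads to the
  group along coset representatives. The sides must match: tiles are translated on the left because
  \<alpha>(ge) = \<alpha>(g)\<alpha>(e) makes the trajectory of gE an image of that of E, and moving
  inside a left translate is right multiplication by some inv(e)e', which a right Folner net
  controls. The powers of one scalar of infinite order would not do: 1, 2, ..., 2^(L-1) have 2^L
  subset sums, so the bound per element does not decay. A second, independent scalar enlarges the
  tile to L^2 elements. If no nonzero scalar has infinite order, no such pair exists, but then K is
  a directed union of finite subfields; as K is infinite, their orders q are unbounded, and log q /
  (q - 1) tends to 0. Over a finite field the claim fails: G is finite, and X = A gives log|A| / |G|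
  > 0.\<close>

definition has_Folner_sets :: "('g, 'x) monoid_scheme \<Rightarrow> bool" where
  "has_Folner_sets G \<longleftrightarrow>
     (\<forall>S \<epsilon>. finite S \<and> S \<subseteq> carrier G \<and> \<epsilon> > 0 \<longrightarrow>
        (\<exists>F. finite F \<and> F \<noteq> {} \<and> F \<subseteq> carrier G \<and>
           (\<forall>s\<in>S. real (card ((F #>\<^bsub>G\<^esub> s) - F)) \<le> \<epsilon> * real (card F))))"

lemma has_Folner_setsD:
  assumes "has_Folner_sets G" "finite S" "S \<subseteq> carrier G" "\<epsilon> > 0"
  obtains F where "finite F" "F \<noteq> {}" "F \<subseteq> carrier G"
    "\<And>s. s \<in> S \<Longrightarrow> real (card ((F #>\<^bsub>G\<^esub> s) - F)) \<le> \<epsilon> * real (card F)"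
  using assms unfolding has_Folner_sets_def by meson

lemma finite_r_coset: "finite F \<Longrightarrow> finite (F #>\<^bsub>G\<^esub> g)"
  by (simp add: r_coset_def)

lemma (in group) card_r_coset:
  assumes "F \<subseteq> carrier G" "g \<in> carrier G"
  shows "card (F #> g) = card F"
proof -
  have "F #> g = (\<lambda>x. x \<otimes> g) ` F"
    by (auto simp: r_coset_def)
  moreover have "inj_on (\<lambda>x. x \<otimes> g) F"
    using assms by (auto simp: inj_on_def subset_iff)
  ultimately show ?thesis
    by (simp add: card_image)
qed

text \<open>If every ratio exceeded 1 + \<epsilon>, then \<open>f\<close> would grow exponentially,
  against the polynomial bound.\<close>

lemma polynomial_growth_ratio:
  fixes f :: "nat \<Rightarrow> nat" and \<epsilon> :: real
  assumes "f 0 > 0" and "\<And>L. f L \<le> (L + 1) ^ k" and "\<epsilon> > 0"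
  obtains L where "real (f (Suc L)) \<le> (1 + \<epsilon>) * real (f L)"
proof (rule ccontr)
  assume "\<not> thesis"
  then have *: "real (f (Suc L)) > (1 + \<epsilon>) * real (f L)" for L
    using that[of L] by linarith
  have low: "(1 + \<epsilon>) ^ L \<le> real (f L)" for L
  proof (induction L)
    case 0
    then show ?case using assms(1) by simp
  next
    case (Suc L)
    have "(1 + \<epsilon>) ^ Suc L \<le> (1 + \<epsilon>) * real (f L)"
      using Suc assms(3) by simp
    then show ?case using *[of L] by linarith
  qed
  have "(\<lambda>L. (real L + 1) ^ k / (1 + \<epsilon>) ^ L) \<longlonglongrightarrow> 0"
    using assms(3) by real_asymp
  then have "\<forall>\<^sub>F L in sequentially. (real L + 1) ^ k / (1 + \<epsilon>) ^ L < 1"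
    by (rule order_tendstoD) simp
  then obtain L where "(real L + 1) ^ k / (1 + \<epsilon>) ^ L < 1"
    by (meson eventually_at_top_linorder order_refl)
  then have "(real L + 1) ^ k < (1 + \<epsilon>) ^ L"
    using assms(3) by (simp add: divide_simps)
  also have "\<dots> \<le> real (f L)" by (rule low)
  also have "\<dots> \<le> real ((L + 1) ^ k)"
    using assms(2)[of L] by (simp only: of_nat_le_iff)
  also have "\<dots> = (real L + 1) ^ k"
    by (simp add: add.commute)
  finally show False by simp
qed

text \<open>Products of elements of \<open>S\<close> with exponents at most L number at most (L +
  1)^|S| by commutativity. Multiplication by an element of \<open>S\<close> leads from box L into
  box L + 1, so a box that hardly grows in the next step is almost invariant.\<close>

lemma (in comm_group) has_Folner_sets_comm: "has_Folner_sets G"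
  unfolding has_Folner_sets_def
proof (intro allI impI, elim conjE)
  fix S and \<epsilon> :: real
  assume S: "finite S" "S \<subseteq> carrier G" and \<epsilon>: "\<epsilon> > 0"
  define m where "m a = finprod G (\<lambda>s. s [^] (a s :: nat)) S" for a
  define B where "B L = m ` (S \<rightarrow>\<^sub>E {..L})" for L
  have fin: "finite (B L)" for L
    unfolding B_def using S by (intro finite_imageI finite_PiE) auto
  have carr: "B L \<subseteq> carrier G" for L
    unfolding B_def m_def using S by (auto intro!: finprod_closed)
  have ne: "B L \<noteq> {}" for L
    unfolding B_def by (auto simp: PiE_eq_empty_iff)
  have mono: "B L \<subseteq> B (Suc L)" for L
    unfolding B_def by (intro image_mono PiE_mono) auto
  have step: "B L #> s \<subseteq> B (Suc L)" if s: "s \<in> S" for s L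
  proof
    fix x assume "x \<in> B L #> s"
    then obtain a where a: "a \<in> S \<rightarrow>\<^sub>E {..L}" and x: "x = m a \<otimes> s"
      by (auto simp: B_def r_coset_def)
    \<comment> \<open>Commutativity lets the new factor \<open>s\<close> be absorbed into the
      exponent of \<open>s\<close>.\<close>
    define a' where "a' = a(s := Suc (a s))"
    have a': "a' \<in> S \<rightarrow>\<^sub>E {..Suc L}"
      using a s by (auto simp: a'_def PiE_iff extensional_def le_Suc_eq)
    define S' where "S' = S - {s}"
    have S': "S = insert s S'" "s \<notin> S'" "finite S'" "S' \<subseteq> carrier G" "s \<in> carrier G"
      using S s by (auto simp: S'_def)
    have "m b = s [^] b s \<otimes> finprod G (\<lambda>s. s [^] b s) S'" for b
      unfolding m_def S'(1) using S' by (subst finprod_insert) auto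
    moreover have "finprod G (\<lambda>s. s [^] a' s) S' = finprod G (\<lambda>s. s [^] a s) S'"
      using S' by (intro finprod_cong') (auto simp: a'_def)
    moreover have "finprod G (\<lambda>s. s [^] a s) S' \<in> carrier G"
      using S' by (intro finprod_closed) auto
    ultimately have "m a' = x"
      using S' x by (simp add: a'_def m_ac)
    then show "x \<in> B (Suc L)"
      using a' by (auto simp: B_def)
  qed
  have "card (B L) \<le> (L + 1) ^ card S" for L
  proof -
    have "card (B L) \<le> card (S \<rightarrow>\<^sub>E {..L})"
      unfolding B_def using S by (intro card_image_le finite_PiE) auto
    also have "\<dots> = (L + 1) ^ card S"
      using S by (simp add: card_PiE)
    finally show ?thesis .
  qed
  moreover have "card (B 0) > 0"
    using fin ne by (simp add: card_gt_0_iff)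
  ultimately obtain L where L: "real (card (B (Suc L))) \<le> (1 + \<epsilon>) * real (card (B L))"
    using polynomial_growth_ratio[of "\<lambda>L. card (B L)" "card S" \<epsilon>] \<epsilon> by blast
  have "real (card ((B L #> s) - B L)) \<le> \<epsilon> * real (card (B L))" if "s \<in> S" for s
  proof -
    have "card ((B L #> s) - B L) \<le> card (B (Suc L) - B L)"
      using step[OF that] fin by (intro card_mono) auto
    moreover have "card (B (Suc L) - B L) = card (B (Suc L)) - card (B L)"
      using mono fin by (intro card_Diff_subset) auto
    moreover have "card (B L) \<le> card (B (Suc L))"
      using mono fin by (intro card_mono) auto
    ultimately have "real (card ((B L #> s) - B L)) \<le> real (card (B (Suc L))) - real (card (B L))"
      by linarith
    then show ?thesis using L by (simp add: algebra_simps)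
  qed
  then show "\<exists>F. finite F \<and> F \<noteq> {} \<and> F \<subseteq> carrier G \<and>
      (\<forall>s\<in>S. real (card ((F #> s) - F)) \<le> \<epsilon> * real (card F))"
    using fin ne carr by (intro exI[of _ "B L"]) simp
qed

text \<open>A Folner set of the group is assembled as \<open>E \<cdot> r(F')\<close> from a Folner set \<open>F'\<close> of the quotient,
  a section \<open>r\<close> and a set \<open>E\<close> that is Folner for the finitely many kernel elements
  \<open>r(q) s r(q h(s))\<^sup>-\<^sup>1\<close>.\<close>

lemma (in group_hom) has_Folner_sets_extension:
  assumes surj: "h ` carrier G = carrier H"
    and ker: "has_Folner_sets (G\<lparr>carrier := kernel G H h\<rparr>)" and quot: "has_Folner_sets H"
  shows "has_Folner_sets G"
  unfolding has_Folner_sets_def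
proof (intro allI impI, elim conjE)
  fix S and \<epsilon> :: real
  assume S: "finite S" "S \<subseteq> carrier G" and \<epsilon>: "\<epsilon> > 0"
  \<comment> \<open>A set-theoretic section only; its failure to be multiplicative is recorded by
    \<open>c\<close> below, with values in the kernel.\<close>
  define r where "r q = (SOME g. g \<in> carrier G \<and> h g = q)" for q
  have r: "r q \<in> carrier G \<and> h (r q) = q" if "q \<in> carrier H" for q
  proof -
    have "\<exists>g. g \<in> carrier G \<and> h g = q" using that surj[symmetric] by auto
    then show ?thesis unfolding r_def by (rule someI_ex)
  qed
  \<comment> \<open>Half of the error is reserved for base points leaving \<open>F'\<close>, half
    for points leaving \<open>E\<close> inside a fibre.\<close>
  have "finite (h ` S)" "h ` S \<subseteq> carrier H" "\<epsilon> / 2 > 0"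
    using S \<epsilon> by auto
  from has_Folner_setsD[OF quot this]
  obtain F' where F': "finite F'" "F' \<noteq> {}" "F' \<subseteq> carrier H"
    and F'2: "\<And>s. s \<in> S \<Longrightarrow> real (card ((F' #>\<^bsub>H\<^esub> h s) - F')) \<le> \<epsilon> / 2 * real (card F')"
    by (metis imageI)
  define c where "c q s = r q \<otimes> s \<otimes> inv (r (q \<otimes>\<^bsub>H\<^esub> h s))" for q s
  have carrF: "q \<in> carrier H" if "q \<in> F'" for q using F' that by auto
  have carrS: "s \<in> carrier G" if "s \<in> S" for s using S that by auto
  have r': "r (q \<otimes>\<^bsub>H\<^esub> h s) \<in> carrier G \<and> h (r (q \<otimes>\<^bsub>H\<^esub> h s)) = q \<otimes>\<^bsub>H\<^esub> h s"
    if "q \<in> F'" "s \<in> S" for q s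
    using r[of "q \<otimes>\<^bsub>H\<^esub> h s"] that carrF carrS by auto
  have cK: "c q s \<in> kernel G H h" if "q \<in> F'" "s \<in> S" for q s
    using r[OF carrF[OF that(1)]] r'[OF that] carrS[OF that(2)] carrF[OF that(1)]
    by (auto simp: c_def kernel_def)
  have c_eq: "r q \<otimes> s = c q s \<otimes> r (q \<otimes>\<^bsub>H\<^esub> h s)" if "q \<in> F'" "s \<in> S" for q s
    using r[OF carrF[OF that(1)]] r'[OF that] carrS[OF that(2)]
    by (simp add: c_def G.m_assoc)
  define T where "T = (\<lambda>(q, s). c q s) ` (F' \<times> S)"
  have T: "finite T" "T \<subseteq> carrier (G\<lparr>carrier := kernel G H h\<rparr>)"
    using F' S cK by (auto simp: T_def)
  obtain E where E: "finite E" "E \<noteq> {}" "E \<subseteq> kernel G H h"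
    and E2: "\<And>t. t \<in> T \<Longrightarrow> real (card ((E #> t) - E)) \<le> \<epsilon> / 2 * real (card E)"
    using has_Folner_setsD[OF ker T, of "\<epsilon> / 2"] \<epsilon> by auto
  have EG: "e \<in> carrier G" "h e = \<one>\<^bsub>H\<^esub>" if "e \<in> E" for e
    using E(3) that by (auto simp: kernel_def)
  define F where "F = (\<lambda>(e, q). e \<otimes> r q) ` (E \<times> F')"
  have "inj_on (\<lambda>(e, q). e \<otimes> r q) (E \<times> F')"
  proof (rule inj_onI, clarify)
    fix e q e' q' assume *: "e \<in> E" "q \<in> F'" "e' \<in> E" "q' \<in> F'" "e \<otimes> r q = e' \<otimes> r q'"
    note rr = r[OF carrF[OF *(2)]] r[OF carrF[OF *(4)]]
    have "h (e \<otimes> r q) = h (e' \<otimes> r q')" using * by simp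
    then have "q = q'" using rr carrF[OF *(2)] carrF[OF *(4)] EG[OF *(1)] EG[OF *(3)] by simp
    moreover from this have "e = e'"
      using *(5) rr EG[OF *(1)] EG[OF *(3)] by simp
    ultimately show "e = e' \<and> q = q'" by simp
  qed
  then have cardF: "card F = card E * card F'"
    unfolding F_def by (simp add: card_image card_cartesian_product)
  have F: "finite F" "F \<noteq> {}" "F \<subseteq> carrier G"
    unfolding F_def using E F' EG r carrF by auto
  have "real (card ((F #> s) - F)) \<le> \<epsilon> * real (card F)" if s: "s \<in> S" for s
  proof -
    define D where "D = {q \<in> F'. q \<otimes>\<^bsub>H\<^esub> h s \<notin> F'}"
    have cT: "c q s \<in> T" if "q \<in> F'" for q using that s by (auto simp: T_def)
    have "card D = card ((\<lambda>q. q \<otimes>\<^bsub>H\<^esub> h s) ` D)"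
      using carrS[OF s] carrF
      by (intro card_image[symmetric] inj_onI) (metis (no_types, lifting) D_def H.right_cancel hom_closed mem_Collect_eq)
    also have "\<dots> \<le> card ((F' #>\<^bsub>H\<^esub> h s) - F')"
      using F' by (intro card_mono finite_Diff finite_r_coset) (auto simp: D_def r_coset_def)
    finally have D: "real (card D) \<le> \<epsilon> / 2 * real (card F')"
      using F'2[OF s] by linarith
    \<comment> \<open>\<open>P\<close> holds the points that leave \<open>E\<close> under the kernel
      element \<open>c q s\<close>; \<open>Q\<close> holds the whole fibres whose base point leaves
      \<open>F'\<close>. Right multiplication by the section carries them onto everything in F s
      outside F.\<close>
    define P where "P = (SIGMA q:F'. (E #> c q s) - E)"
    define Q where "Q = (SIGMA q:D. E #> c q s)"
    have finEc: "finite (E #> g)" for g using E by (intro finite_r_coset)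
    have finD: "finite D" using F' by (auto simp: D_def)
    have finPQ: "finite (P \<union> Q)"
      unfolding P_def Q_def using finEc F' finD by auto
    have "(F #> s) - F \<subseteq> (\<lambda>(q, x). x \<otimes> r (q \<otimes>\<^bsub>H\<^esub> h s)) ` (P \<union> Q)"
    proof
      fix y assume y: "y \<in> (F #> s) - F"
      then obtain e q where eq: "e \<in> E" "q \<in> F'" "y = e \<otimes> r q \<otimes> s"
        by (auto simp: F_def r_coset_def)
      have ck: "c q s \<in> carrier G" using cK[OF eq(2) s] by (auto simp: kernel_def)
      have y_eq: "y = (e \<otimes> c q s) \<otimes> r (q \<otimes>\<^bsub>H\<^esub> h s)"
        using eq r[OF carrF[OF eq(2)]] r'[OF eq(2) s] carrS[OF s] EG[OF eq(1)] ck c_eq[OF eq(2) s]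
        by (simp add: G.m_assoc)
      have "(q, e \<otimes> c q s) \<in> P \<union> Q"
      proof (cases "q \<otimes>\<^bsub>H\<^esub> h s \<in> F'")
        case True
        then have "e \<otimes> c q s \<notin> E" using y y_eq by (auto simp: F_def)
        then show ?thesis using eq by (auto simp: P_def r_coset_def)
      next
        case False
        then show ?thesis using eq by (auto simp: Q_def D_def r_coset_def)
      qed
      then show "y \<in> (\<lambda>(q, x). x \<otimes> r (q \<otimes>\<^bsub>H\<^esub> h s)) ` (P \<union> Q)"
        using y_eq by force
    qed
    then have "card ((F #> s) - F) \<le> card (P \<union> Q)"
      using finPQ by (meson card_image_le card_mono finite_imageI le_trans)
    also have "\<dots> \<le> card P + card Q" by (rule card_Un_le)
    finally have *: "real (card ((F #> s) - F)) \<le> real (card P) + real (card Q)"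
      by linarith
    have "real (card P) = (\<Sum>q\<in>F'. real (card ((E #> c q s) - E)))"
      unfolding P_def using F' finEc by (subst card_SigmaI) auto
    also have "\<dots> \<le> (\<Sum>q\<in>F'. \<epsilon> / 2 * real (card E))"
      by (intro sum_mono E2 cT)
    also have "\<dots> = \<epsilon> / 2 * real (card E) * real (card F')" by simp
    finally have P: "real (card P) \<le> \<epsilon> / 2 * real (card E) * real (card F')" .
    have "card Q = (\<Sum>q\<in>D. card (E #> c q s))"
      unfolding Q_def using finD finEc by (subst card_SigmaI) auto
    also have "\<dots> = (\<Sum>q\<in>D. card E)"
    proof (rule sum.cong)
      fix q assume "q \<in> D"
      then show "card (E #> c q s) = card E"
        using cK[of q s] s EG by (intro G.card_r_coset) (auto simp: D_def kernel_def)
    qed simp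
    finally have "real (card Q) = real (card E) * real (card D)" by simp
    also have "\<dots> \<le> real (card E) * (\<epsilon> / 2 * real (card F'))"
      using D by (intro mult_left_mono) auto
    finally show ?thesis using * P by (simp add: cardF algebra_simps)
  qed
  then show "\<exists>F. finite F \<and> F \<noteq> {} \<and> F \<subseteq> carrier G \<and>
      (\<forall>s\<in>S. real (card ((F #> s) - F)) \<le> \<epsilon> * real (card F))"
    using F by (intro exI[of _ F]) simp
qed

text \<open>Replacing \<open>H\<close> by the image of \<open>h\<close>, again abelian, removes the
  need to check surjectivity.\<close>

lemma (in group_hom) has_Folner_sets_comm_extension:
  assumes "comm_group H" and "has_Folner_sets (G\<lparr>carrier := kernel G H h\<rparr>)"
  shows "has_Folner_sets G"
proof -
  let ?H = "H\<lparr>carrier := h ` carrier G\<rparr>"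
  have sub: "subgroup (h ` carrier G) H" by (rule img_is_subgroup)
  have grp: "group ?H" using sub by (rule H.subgroup_imp_group)
  have comm: "comm_group ?H"
  proof (rule group.group_comm_groupI[OF grp])
    interpret H: comm_group H by fact
    fix x y assume "x \<in> carrier ?H" "y \<in> carrier ?H"
    then show "x \<otimes>\<^bsub>?H\<^esub> y = y \<otimes>\<^bsub>?H\<^esub> x" by (auto intro: H.m_comm)
  qed
  interpret h': group_hom G ?H h
    by (intro group_hom.intro group_hom_axioms.intro grp G.is_group homI) auto
  show ?thesis
  proof (rule h'.has_Folner_sets_extension)
    show "has_Folner_sets (G\<lparr>carrier := kernel G ?H h\<rparr>)"
      using assms(2) by (simp add: kernel_def)
    show "has_Folner_sets ?H"
      using comm by (rule comm_group.has_Folner_sets_comm)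
  qed simp
qed

text \<open>The net is the identity family, under the filter generated by the sets
  \<open>U (S, \<epsilon>)\<close> of almost invariant sets. These are nonempty and directed (unite
  the \<open>S\<close>, take the smaller \<epsilon>), so the filter is proper. The index type is the
  one over which \<open>H_alg\<close> quantifies.\<close>

lemma (in group) Folner_net_exists:
  assumes "has_Folner_sets G"
  obtains F :: "'a set \<Rightarrow> 'a set" and \<Phi> where "right_Folner_net G F \<Phi>"
proof -
  define U where "U = (\<lambda>(S, \<epsilon> :: real). {F. finite F \<and> F \<noteq> {} \<and> F \<subseteq> carrier G \<and>
     (\<forall>s\<in>S. real (card ((F #> s) - F)) \<le> \<epsilon> * real (card F))})"
  define I where "I = {(S, \<epsilon> :: real). finite S \<and> S \<subseteq> carrier G \<and> \<epsilon> > 0}"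
  define \<Phi> where "\<Phi> = (INF i\<in>I. principal (U i))"
  have I_ne: "I \<noteq> {}" unfolding I_def by (auto intro!: exI[of _ "{}"] exI[of _ 1])
  have dir: "\<exists>k\<in>I. principal (U k) \<le> inf (principal (U i)) (principal (U j))" if "i \<in> I" "j \<in> I" for i j
  proof -
    obtain S \<epsilon> S' \<epsilon>' where ij: "i = (S, \<epsilon>)" "j = (S', \<epsilon>')" by fastforce
    have "U (S \<union> S', min \<epsilon> \<epsilon>') \<subseteq> U i \<inter> U j"
    proof
      fix F assume F: "F \<in> U (S \<union> S', min \<epsilon> \<epsilon>')"
      have "min \<epsilon> \<epsilon>' * real (card F) \<le> \<epsilon> * real (card F)"
        "min \<epsilon> \<epsilon>' * real (card F) \<le> \<epsilon>' * real (card F)"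
        by (intro mult_right_mono; simp)+
      then show "F \<in> U i \<inter> U j"
        using F by (force simp: U_def ij)
    qed
    moreover have "(S \<union> S', min \<epsilon> \<epsilon>') \<in> I"
      using that by (auto simp: I_def ij)
    ultimately show ?thesis by (metis inf_principal principal_le_iff)
  qed
  have ev: "eventually P \<Phi> \<longleftrightarrow> (\<exists>i\<in>I. \<forall>F\<in>U i. P F)" for P
    unfolding \<Phi>_def by (subst eventually_INF_base[OF I_ne dir]) (auto simp: eventually_principal)
  have U_ne: "U i \<noteq> {}" if "i \<in> I" for i
  proof -
    obtain S \<epsilon> where i: "i = (S, \<epsilon>)" by fastforce
    then have "finite S" "S \<subseteq> carrier G" "\<epsilon> > 0" using that by (auto simp: I_def)
    from has_Folner_setsD[OF assms this] show ?thesis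
      unfolding i U_def by (simp add: ex_in_conv[symmetric]) metis
  qed
  have "right_Folner_net G (\<lambda>F. F) \<Phi>"
    unfolding right_Folner_net_def
  proof (intro conjI ballI)
    show "\<Phi> \<noteq> bot"
      using U_ne unfolding trivial_limit_def ev by blast
    obtain i where "i \<in> I" using I_ne by blast
    then show "\<forall>\<^sub>F F in \<Phi>. finite F \<and> F \<noteq> {} \<and> F \<subseteq> carrier G"
      unfolding ev by (intro bexI[of _ i]) (auto simp: U_def)
    fix g assume g: "g \<in> carrier G"
    show "((\<lambda>F. real (card ((F #> g) - F)) / real (card F)) \<longlongrightarrow> 0) \<Phi>"
    proof (rule tendstoI)
      fix e :: real assume e: "e > 0"
      have "dist (real (card ((F #> g) - F)) / real (card F)) 0 < e" if "F \<in> U ({g}, e / 2)" for F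
      proof -
        have F: "real (card ((F #> g) - F)) \<le> e / 2 * real (card F)" "card F > 0"
          using that by (auto simp: U_def card_gt_0_iff)
        then have "real (card ((F #> g) - F)) / real (card F) \<le> e / 2"
          by (simp add: divide_simps)
        also have "\<dots> < e" using e by simp
        finally show ?thesis by simp
      qed
      moreover have "({g}, e / 2) \<in> I" using g e by (auto simp: I_def)
      ultimately show "\<forall>\<^sub>F F in \<Phi>. dist (real (card ((F #> g) - F)) / real (card F)) 0 < e"
        unfolding ev by blast
    qed
  qed
  then show thesis by (rule that)
qed

subsection \<open>Entropy and tilings\<close>

text \<open>The partition is encoded by a function: \<open>\<beta> g\<close> is the base point of
  the translate containing \<open>g\<close>. That \<open>\<beta>\<close> is constant on each
  translate expresses disjointness.\<close>

definition left_tile :: "('g, 'x) monoid_scheme \<Rightarrow> 'g set \<Rightarrow> bool" where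
  "left_tile G E \<longleftrightarrow> finite E \<and> E \<noteq> {} \<and> E \<subseteq> carrier G \<and>
     (\<exists>\<beta>. \<forall>g\<in>carrier G. \<beta> g \<in> carrier G \<and> g \<in> (\<lambda>e. \<beta> g \<otimes>\<^bsub>G\<^esub> e) ` E \<and>
        (\<forall>e\<in>E. \<beta> (\<beta> g \<otimes>\<^bsub>G\<^esub> e) = \<beta> g))"

locale automorphism_action =
  G: group G + A: comm_group A
  for G :: "('g, 'x) monoid_scheme" and A :: "('a, 'c) monoid_scheme" +
  fixes \<alpha> :: "'g \<Rightarrow> 'a \<Rightarrow> 'a"
  assumes action_hom: "\<alpha> \<in> hom G (AutoGroup A)"
begin

abbreviation traj :: "'g set \<Rightarrow> 'a set \<Rightarrow> 'a set" where
  "traj \<equiv> alg_trajectory A \<alpha>"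

lemma act_hom: "g \<in> carrier G \<Longrightarrow> \<alpha> g \<in> hom A A"
  using action_hom by (auto simp: hom_def AutoGroup_def auto_def)

lemma act_closed [simp]: "g \<in> carrier G \<Longrightarrow> x \<in> carrier A \<Longrightarrow> \<alpha> g x \<in> carrier A"
  using act_hom[of g] by (auto simp: hom_def)

lemma act_mult:
  assumes "g \<in> carrier G" "h \<in> carrier G" "x \<in> carrier A"
  shows "\<alpha> (g \<otimes>\<^bsub>G\<^esub> h) x = \<alpha> g (\<alpha> h x)"
proof -
  have "\<alpha> (g \<otimes>\<^bsub>G\<^esub> h) = \<alpha> g \<otimes>\<^bsub>AutoGroup A\<^esub> \<alpha> h"
    using action_hom assms by (auto simp: hom_def)
  moreover have "\<alpha> g \<in> Bij (carrier A)" "\<alpha> h \<in> Bij (carrier A)"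
    using action_hom assms by (auto simp: hom_def AutoGroup_def auto_def)
  ultimately show ?thesis
    using assms by (simp add: AutoGroup_def BijGroup_def compose_def)
qed

lemma act_finprod:
  assumes "g \<in> carrier G" "finite F" "y \<in> F \<rightarrow> carrier A"
  shows "\<alpha> g (finprod A y F) = finprod A (\<lambda>h. \<alpha> g (y h)) F"
proof -
  interpret g: group_hom A A "\<alpha> g"
    using act_hom[OF assms(1)] by unfold_locales
  show ?thesis
    using assms(2,3) by (induction F) (auto simp: assms(1) Pi_iff)
qed

text \<open>The choice functions in \<open>alg_trajectory\<close> are arbitrary outside
  \<open>F\<close>; making them extensional leaves a finite product that can be counted.\<close>

lemma traj_eq_image_PiE:
  assumes "F \<subseteq> carrier G" "X \<subseteq> carrier A"
  shows "traj F X = (\<lambda>y. finprod A y F) ` (\<Pi>\<^sub>E g\<in>F. \<alpha> g ` X)"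
proof
  show "traj F X \<subseteq> (\<lambda>y. finprod A y F) ` (\<Pi>\<^sub>E g\<in>F. \<alpha> g ` X)"
  proof
    fix z assume "z \<in> traj F X"
    then obtain y where y: "z = finprod A y F" "\<forall>g\<in>F. y g \<in> \<alpha> g ` X"
      by (auto simp: alg_trajectory_def)
    have "finprod A (restrict y F) F = finprod A y F"
      using assms y(2) by (intro A.finprod_cong') (auto simp: image_iff subset_iff)
    then show "z \<in> (\<lambda>y. finprod A y F) ` (\<Pi>\<^sub>E g\<in>F. \<alpha> g ` X)"
      using y by (intro image_eqI[of _ _ "restrict y F"]) auto
  qed
  show "(\<lambda>y. finprod A y F) ` (\<Pi>\<^sub>E g\<in>F. \<alpha> g ` X) \<subseteq> traj F X"
    by (auto simp: alg_trajectory_def)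
qed

lemma finite_traj:
  assumes "finite F" "F \<subseteq> carrier G" "finite X" "X \<subseteq> carrier A"
  shows "finite (traj F X)"
  using assms by (auto simp: traj_eq_image_PiE intro!: finite_imageI finite_PiE)

lemma traj_nonempty:
  assumes "X \<noteq> {}"
  shows "traj F X \<noteq> {}"
proof -
  obtain x where "x \<in> X" using assms by blast
  then have "finprod A (\<lambda>g. \<alpha> g x) F \<in> traj F X"
    by (auto simp: alg_trajectory_def)
  then show ?thesis by blast
qed

lemma card_traj_pos:
  assumes "finite F" "F \<subseteq> carrier G" "finite X" "X \<noteq> {}" "X \<subseteq> carrier A"
  shows "card (traj F X) > 0"
  using finite_traj[OF assms(1-3,5)] traj_nonempty[OF assms(4)] by (simp add: card_gt_0_iff)

lemma card_traj_le:
  assumes "finite F" "F \<subseteq> carrier G" "finite X" "X \<subseteq> carrier A"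
  shows "card (traj F X) \<le> card X ^ card F"
proof -
  have "card (traj F X) \<le> card (\<Pi>\<^sub>E g\<in>F. \<alpha> g ` X)"
    unfolding traj_eq_image_PiE[OF assms(2,4)]
    using assms by (intro card_image_le finite_PiE) auto
  also have "\<dots> = (\<Prod>g\<in>F. card (\<alpha> g ` X))"
    using assms by (simp add: card_PiE)
  also have "\<dots> \<le> (\<Prod>g\<in>F. card X)"
    using assms by (intro prod_mono) (auto intro: card_image_le)
  finally show ?thesis by simp
qed

text \<open>A sum over the union splits into one summand from each trajectory, so log|T| is
  subadditive.\<close>

lemma card_traj_Un_disjoint:
  assumes "finite F" "F \<subseteq> carrier G" "finite F'" "F' \<subseteq> carrier G" "F \<inter> F' = {}"
    and "finite X" "X \<subseteq> carrier A"
  shows "card (traj (F \<union> F') X) \<le> card (traj F X) * card (traj F' X)"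
proof -
  have "traj (F \<union> F') X \<subseteq> (\<lambda>(u, v). u \<otimes>\<^bsub>A\<^esub> v) ` (traj F X \<times> traj F' X)"
  proof
    fix z assume "z \<in> traj (F \<union> F') X"
    then obtain y where y: "z = finprod A y (F \<union> F')" "\<forall>g\<in>F \<union> F'. y g \<in> \<alpha> g ` X"
      by (auto simp: alg_trajectory_def)
    have c: "y \<in> F \<rightarrow> carrier A" "y \<in> F' \<rightarrow> carrier A"
      using y(2) assms(2,4,7) by (auto simp: image_iff subset_iff) (metis UnCI act_closed)+
    have "z = finprod A y F \<otimes>\<^bsub>A\<^esub> finprod A y F'"
      unfolding y(1) using assms c by (intro A.finprod_Un_disjoint)
    moreover have "finprod A y F \<in> traj F X" "finprod A y F' \<in> traj F' X"
      using y(2) by (auto simp: alg_trajectory_def)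
    ultimately show "z \<in> (\<lambda>(u, v). u \<otimes>\<^bsub>A\<^esub> v) ` (traj F X \<times> traj F' X)"
      by blast
  qed
  then have "card (traj (F \<union> F') X) \<le> card (traj F X \<times> traj F' X)"
    using finite_traj assms by (intro surj_card_le) auto
  then show ?thesis by (simp add: card_cartesian_product)
qed

lemma card_traj_UN_disjoint:
  assumes "finite I" "\<And>i. i \<in> I \<Longrightarrow> finite (F i)" "\<And>i. i \<in> I \<Longrightarrow> F i \<subseteq> carrier G"
    and "disjoint_family_on F I" "finite X" "X \<subseteq> carrier A"
  shows "card (traj (\<Union>i\<in>I. F i) X) \<le> (\<Prod>i\<in>I. card (traj (F i) X))"
  using assms(1-4)
proof (induction I)
  case empty
  then show ?case using card_traj_le[of "{}" X] assms(5,6) by simp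
next
  case (insert i I)
  have "F i \<inter> (\<Union>j\<in>I. F j) = {}"
    using insert.prems(3) insert.hyps by (auto simp: disjoint_family_on_def)
  then have "card (traj (F i \<union> (\<Union>j\<in>I. F j)) X) \<le> card (traj (F i) X) * card (traj (\<Union>j\<in>I. F j) X)"
    using insert.prems insert.hyps assms(5,6) by (intro card_traj_Un_disjoint) auto
  also have "\<dots> \<le> card (traj (F i) X) * (\<Prod>i\<in>I. card (traj (F i) X))"
    using insert.prems by (intro mult_left_mono insert.IH) (auto simp: disjoint_family_on_def)
  finally show ?case using insert.hyps by simp
qed

text \<open>Since \<alpha>(ge) = \<alpha>(g)\<alpha>(e) and \<alpha>(g) is additive, the trajectory
  of the translate lies in the image of the trajectory of \<open>E\<close> under
  \<alpha>(g).\<close>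

lemma card_traj_translate:
  assumes g: "g \<in> carrier G" and E: "finite E" "E \<subseteq> carrier G"
    and X: "finite X" "X \<subseteq> carrier A"
  shows "card (traj ((\<lambda>e. g \<otimes>\<^bsub>G\<^esub> e) ` E) X) \<le> card (traj E X)"
proof -
  have inj: "inj_on (\<lambda>e. g \<otimes>\<^bsub>G\<^esub> e) E"
    using g E by (auto simp: inj_on_def subset_iff)
  have "traj ((\<lambda>e. g \<otimes>\<^bsub>G\<^esub> e) ` E) X \<subseteq> \<alpha> g ` traj E X"
  proof
    fix z assume "z \<in> traj ((\<lambda>e. g \<otimes>\<^bsub>G\<^esub> e) ` E) X"
    then obtain y where y: "z = finprod A y ((\<lambda>e. g \<otimes>\<^bsub>G\<^esub> e) ` E)"
      "\<forall>e\<in>E. y (g \<otimes>\<^bsub>G\<^esub> e) \<in> \<alpha> (g \<otimes>\<^bsub>G\<^esub> e) ` X"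
      by (auto simp: alg_trajectory_def)
    have "\<forall>e\<in>E. \<exists>x\<in>X. y (g \<otimes>\<^bsub>G\<^esub> e) = \<alpha> g (\<alpha> e x)"
      using y(2) g E X by (auto simp: image_iff subset_iff act_mult)
    then obtain x where x: "\<And>e. e \<in> E \<Longrightarrow> x e \<in> X"
      "\<And>e. e \<in> E \<Longrightarrow> y (g \<otimes>\<^bsub>G\<^esub> e) = \<alpha> g (\<alpha> e (x e))"
      by metis
    have c: "\<alpha> e (x e) \<in> carrier A" if "e \<in> E" for e
      using x(1)[OF that] that E X by (intro act_closed) auto
    have "z = finprod A (\<lambda>e. y (g \<otimes>\<^bsub>G\<^esub> e)) E"
      unfolding y(1) using inj c g x(2) by (intro A.finprod_reindex) auto
    also have "\<dots> = finprod A (\<lambda>e. \<alpha> g (\<alpha> e (x e))) E"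
      using c g x(2) by (intro A.finprod_cong') auto
    also have "\<dots> = \<alpha> g (finprod A (\<lambda>e. \<alpha> e (x e)) E)"
      using g E c by (intro act_finprod[symmetric]) auto
    finally show "z \<in> \<alpha> g ` traj E X"
      using x(1) by (auto simp: alg_trajectory_def)
  qed
  then show ?thesis
    using finite_traj[OF E X] by (intro surj_card_le)
qed

text \<open>The tiles cut \<open>F\<close> into pieces \<open>P c\<close>. Tiles inside
  \<open>F\<close> are disjoint, so at most |F|/|E| in number, and each costs no more than
  \<open>E\<close>. A tile cut by the boundary costs at most |E| log|X|, and the last sum bounds the
  number of such tiles.\<close>

lemma ln_card_traj_tile_bound:
  assumes tile: "left_tile G E"
    and F: "finite F" "F \<subseteq> carrier G" and X: "finite X" "X \<noteq> {}" "X \<subseteq> carrier A"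
  shows "ln (real (card (traj F X))) \<le>
    real (card F) * (ln (real (card (traj E X))) / real (card E)) +
    real (card E) * ln (real (card X)) *
      (\<Sum>(e, e')\<in>E \<times> E. real (card ((F #>\<^bsub>G\<^esub> (inv\<^bsub>G\<^esub> e \<otimes>\<^bsub>G\<^esub> e')) - F)))"
proof -
  have E: "finite E" "E \<noteq> {}" "E \<subseteq> carrier G" using tile by (auto simp: left_tile_def)
  obtain \<beta> where \<beta>: "\<And>g. g \<in> carrier G \<Longrightarrow> \<beta> g \<in> carrier G"
    "\<And>g. g \<in> carrier G \<Longrightarrow> g \<in> (\<lambda>e. \<beta> g \<otimes>\<^bsub>G\<^esub> e) ` E"
    "\<And>g e. g \<in> carrier G \<Longrightarrow> e \<in> E \<Longrightarrow> \<beta> (\<beta> g \<otimes>\<^bsub>G\<^esub> e) = \<beta> g"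
    using tile unfolding left_tile_def by metis
  define C where "C = \<beta> ` F"
  define P where "P c = {g \<in> F. \<beta> g = c}" for c
  define cE where "cE c = (\<lambda>e. c \<otimes>\<^bsub>G\<^esub> e) ` E" for c
  have C: "finite C" "C \<subseteq> carrier G" using F \<beta>(1) by (auto simp: C_def)
  have \<beta>_cE: "\<beta> x = c" if "c \<in> C" "x \<in> cE c" for c x
    using that \<beta>(3) F by (auto simp: C_def cE_def)
  have P_sub: "P c \<subseteq> cE c" for c
    using \<beta>(2) F by (auto simp: P_def cE_def)
  have P_eq: "P c = cE c \<inter> F" if "c \<in> C" for c
    using P_sub[of c] \<beta>_cE[OF that] by (auto simp: P_def)
  have cE: "finite (cE c)" "card (cE c) = card E" if "c \<in> C" for c
  proof -
    have "inj_on (\<lambda>e. c \<otimes>\<^bsub>G\<^esub> e) E"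
      using that C E by (auto simp: inj_on_def subset_iff)
    then show "finite (cE c)" "card (cE c) = card E"
      using E by (simp_all add: cE_def card_image)
  qed
  have finP: "finite (P c)" "P c \<subseteq> carrier G" for c using F by (auto simp: P_def)
  have F_eq: "F = (\<Union>c\<in>C. P c)" by (auto simp: C_def P_def)
  have disj: "disjoint_family_on P C" by (auto simp: disjoint_family_on_def P_def)
  \<comment> \<open>\<open>C1\<close>: base points of the full tiles; \<open>C2\<close>: of those
    that meet \<open>F\<close> without lying inside it.\<close>
  define C1 where "C1 = {c \<in> C. cE c \<subseteq> F}"
  define C2 where "C2 = C - C1"
  have C12: "C = C1 \<union> C2" "C1 \<inter> C2 = {}" "finite C1" "finite C2" "C1 \<subseteq> C" "C2 \<subseteq> C"
    using C by (auto simp: C1_def C2_def)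
  have P_C1: "P c = cE c" if "c \<in> C1" for c
    using that P_eq[of c] by (auto simp: C1_def)
  let ?f = "\<lambda>F. ln (real (card (traj F X)))"
  have pos: "card (traj F' X) > 0" if "finite F'" "F' \<subseteq> carrier G" for F'
    using that X by (intro card_traj_pos)
  have X1: "real (card X) \<ge> 1" using X by (simp add: Suc_le_eq card_gt_0_iff)
  have "card (traj F X) \<le> (\<Prod>c\<in>C. card (traj (P c) X))"
    using card_traj_UN_disjoint[OF C(1) finP disj X(1,3)] F_eq by simp
  then have "real (card (traj F X)) \<le> (\<Prod>c\<in>C. real (card (traj (P c) X)))"
    by (simp flip: of_nat_prod)
  then have "?f F \<le> ln (\<Prod>c\<in>C. real (card (traj (P c) X)))"
    using pos[OF F] by (subst ln_le_cancel_iff) (auto intro!: prod_pos pos finP)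
  also have "\<dots> = (\<Sum>c\<in>C. ?f (P c))"
    using pos[OF finP] C by (intro ln_prod) auto
  also have "\<dots> = (\<Sum>c\<in>C1. ?f (P c)) + (\<Sum>c\<in>C2. ?f (P c))"
    using C12 by (simp add: sum.union_disjoint)
  finally have split: "?f F \<le> (\<Sum>c\<in>C1. ?f (P c)) + (\<Sum>c\<in>C2. ?f (P c))" .
  have "(\<Sum>c\<in>C1. ?f (P c)) \<le> (\<Sum>c\<in>C1. ?f E)"
  proof (rule sum_mono)
    fix c assume c: "c \<in> C1"
    note P_C1[OF c]
    moreover have "card (traj (cE c) X) \<le> card (traj E X)"
      unfolding cE_def using c C E X C12 by (intro card_traj_translate) auto
    ultimately show "?f (P c) \<le> ?f E"
      using pos[OF finP, of c] by simp
  qed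
  then have full: "(\<Sum>c\<in>C1. ?f (P c)) \<le> real (card C1) * ?f E" by simp
  have "(\<Sum>c\<in>C2. ?f (P c)) \<le> (\<Sum>c\<in>C2. real (card E) * ln (real (card X)))"
  proof (rule sum_mono)
    fix c assume "c \<in> C2"
    then have c: "c \<in> C" using C12 by auto
    have "card (P c) \<le> card E"
      using card_mono[OF cE(1)[OF c] P_sub] cE(2)[OF c] by simp
    moreover have "real (card (traj (P c) X)) \<le> real (card X) ^ card (P c)"
      using card_traj_le[OF finP X(1,3), of c] by (metis of_nat_le_iff of_nat_power)
    ultimately have "real (card (traj (P c) X)) \<le> real (card X) ^ card E"
      using X1 by (meson order_trans power_increasing)
    then have "?f (P c) \<le> ln (real (card X) ^ card E)"
      using pos[OF finP, of c] X1 by (subst ln_le_cancel_iff) auto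
    then show "?f (P c) \<le> real (card E) * ln (real (card X))"
      using X1 by (simp add: ln_realpow)
  qed
  then have boundary: "(\<Sum>c\<in>C2. ?f (P c)) \<le> real (card E) * ln (real (card X)) * real (card C2)"
    by (simp add: mult_ac)
  have card_C1: "real (card C1) * ?f E \<le> real (card F) * (?f E / real (card E))"
  proof -
    have "card (P c) = card E" if "c \<in> C1" for c
      using P_C1[OF that] cE(2)[of c] that C12(5) by auto
    then have "card C1 * card E = (\<Sum>c\<in>C1. card (P c))"
      by simp
    also have "\<dots> \<le> (\<Sum>c\<in>C. card (P c))"
      using C C12 by (intro sum_mono2) auto
    also have "\<dots> = card F"
      using card_UN_disjoint'[OF disj finP(1) C(1)] by (simp flip: F_eq)
    finally have "real (card C1) * real (card E) \<le> real (card F)"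
      by (metis of_nat_le_iff of_nat_mult)
    then have "real (card C1) \<le> real (card F) / real (card E)"
      using E by (simp add: field_simps card_gt_0_iff)
    moreover have "?f E \<ge> 0" using pos[OF E(1,3)] by simp
    ultimately show ?thesis
      using mult_right_mono by fastforce
  qed
  have card_C2: "real (card C2) \<le> (\<Sum>(e, e')\<in>E \<times> E. real (card ((F #>\<^bsub>G\<^esub> (inv\<^bsub>G\<^esub> e \<otimes>\<^bsub>G\<^esub> e')) - F)))"
  proof -
    let ?D = "\<lambda>(e, e'). (F #>\<^bsub>G\<^esub> (inv\<^bsub>G\<^esub> e \<otimes>\<^bsub>G\<^esub> e')) - F"
    have fin: "finite (?D p)" for p using F by (auto split: prod.splits intro: finite_r_coset)
    \<comment> \<open>A cut tile has a point ce in \<open>F\<close> and a point ce' outside. Then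
      ce' = (ce)(inv(e)e') is a boundary point for the pair (e, e'), and \<open>\<beta>\<close>
      recovers \<open>c\<close> from it.\<close>
    have "C2 \<subseteq> \<beta> ` (\<Union>p\<in>E \<times> E. ?D p)"
    proof
      fix c assume "c \<in> C2"
      then have c: "c \<in> C" "\<not> cE c \<subseteq> F" by (auto simp: C1_def C2_def)
      then obtain g where g: "g \<in> F" "\<beta> g = c" by (auto simp: C_def)
      then obtain e where e: "e \<in> E" "g = c \<otimes>\<^bsub>G\<^esub> e"
        using \<beta>(2)[of g] F by auto
      obtain e' where e': "e' \<in> E" "c \<otimes>\<^bsub>G\<^esub> e' \<notin> F"
        using c by (auto simp: cE_def)
      have carr: "c \<in> carrier G" "e \<in> carrier G" "e' \<in> carrier G"
        using c C e e' E by auto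
      then have "e \<otimes>\<^bsub>G\<^esub> (inv\<^bsub>G\<^esub> e \<otimes>\<^bsub>G\<^esub> e') = e'"
        by (simp flip: G.m_assoc)
      then have "c \<otimes>\<^bsub>G\<^esub> e' = g \<otimes>\<^bsub>G\<^esub> (inv\<^bsub>G\<^esub> e \<otimes>\<^bsub>G\<^esub> e')"
        unfolding e(2) using carr by (simp add: G.m_assoc)
      then have "c \<otimes>\<^bsub>G\<^esub> e' \<in> ?D (e, e')"
        using g e' by (auto simp: r_coset_def)
      moreover have "\<beta> (c \<otimes>\<^bsub>G\<^esub> e') = c"
        using \<beta>_cE[OF c(1)] e' by (auto simp: cE_def)
      ultimately show "c \<in> \<beta> ` (\<Union>p\<in>E \<times> E. ?D p)"
        using e(1) e'(1) by (metis (no_types, lifting) SigmaI UN_I image_eqI)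
    qed
    then have "card C2 \<le> card (\<Union>p\<in>E \<times> E. ?D p)"
      using E fin by (intro surj_card_le) auto
    also have "\<dots> \<le> (\<Sum>p\<in>E \<times> E. card (?D p))"
      using E by (intro card_UN_le) auto
    finally have "real (card C2) \<le> real (\<Sum>p\<in>E \<times> E. card (?D p))"
      by (simp only: of_nat_le_iff)
    then show ?thesis by (simp add: case_prod_unfold)
  qed
  have "real (card E) * ln (real (card X)) \<ge> 0" using X1 by simp
  from split full boundary card_C1 mult_left_mono[OF card_C2 this] show ?thesis
    by linarith
qed

text \<open>With \<open>E\<close> fixed before the limit is taken, the boundary term is a constant
  times a finite sum of Folner ratios and vanishes along the net; what remains is the ratio of
  \<open>E\<close>.\<close>

lemma tendsto_zero_if_small_tiles:
  assumes small: "\<And>\<epsilon>. \<epsilon> > 0 \<Longrightarrow>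
      \<exists>E. left_tile G E \<and> ln (real (card (traj E X))) \<le> \<epsilon> * real (card E)"
    and X: "finite X" "X \<noteq> {}" "X \<subseteq> carrier A"
    and net: "right_Folner_net G F \<Phi>"
  shows "((\<lambda>i. ln (real (card (traj (F i) X))) / real (card (F i))) \<longlongrightarrow> 0) \<Phi>"
proof (rule tendstoI)
  fix \<epsilon> :: real assume \<epsilon>: "\<epsilon> > 0"
  then obtain E where E: "left_tile G E"
    and fE: "ln (real (card (traj E X))) \<le> \<epsilon> / 2 * real (card E)"
    using small[of "\<epsilon> / 2"] by auto
  have Efin: "finite E" "E \<noteq> {}" "E \<subseteq> carrier G" using E by (auto simp: left_tile_def)
  then have E0: "real (card E) > 0" by (simp add: card_gt_0_iff)
  let ?r = "\<lambda>i e e'. real (card ((F i #>\<^bsub>G\<^esub> (inv\<^bsub>G\<^esub> e \<otimes>\<^bsub>G\<^esub> e')) - F i)) / real (card (F i))"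
  let ?\<delta> = "\<lambda>i. real (card E) * ln (real (card X)) * (\<Sum>(e, e')\<in>E \<times> E. ?r i e e')"
  have "(?\<delta> \<longlongrightarrow> real (card E) * ln (real (card X)) * (\<Sum>(e, e')\<in>E \<times> E. 0)) \<Phi>"
    using net Efin unfolding right_Folner_net_def case_prod_unfold
    by (intro tendsto_mult tendsto_sum tendsto_const) (auto simp: subset_iff)
  then have "(?\<delta> \<longlongrightarrow> 0) \<Phi>" by simp
  then have "\<forall>\<^sub>F i in \<Phi>. ?\<delta> i < \<epsilon> / 2"
    by (rule order_tendstoD) (use \<epsilon> in simp)
  moreover have "\<forall>\<^sub>F i in \<Phi>. finite (F i) \<and> F i \<noteq> {} \<and> F i \<subseteq> carrier G"
    using net by (simp add: right_Folner_net_def)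
  ultimately show "\<forall>\<^sub>F i in \<Phi>. dist (ln (real (card (traj (F i) X))) / real (card (F i))) 0 < \<epsilon>"
  proof eventually_elim
    case (elim i)
    then have F: "finite (F i)" "F i \<noteq> {}" "F i \<subseteq> carrier G" by auto
    then have F0: "real (card (F i)) > 0" by (simp add: card_gt_0_iff)
    have "card (traj (F i) X) > 0" using F X by (intro card_traj_pos) auto
    then have nonneg: "ln (real (card (traj (F i) X))) \<ge> 0" by simp
    have "ln (real (card (traj (F i) X))) / real (card (F i)) \<le>
        ln (real (card (traj E X))) / real (card E) + ?\<delta> i"
      using ln_card_traj_tile_bound[OF E F(1,3) X] F0
      by (simp add: field_simps sum_divide_distrib case_prod_unfold flip: sum_divide_distrib)
    also have "ln (real (card (traj E X))) / real (card E) \<le> \<epsilon> / 2"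
      using fE E0 by (simp add: field_simps)
    finally show ?case using elim nonneg F0 by simp
  qed
qed

text \<open>\<open>H_alg\<close> is a definite description: the tiles show that 0 qualifies, and one
  existing net with a proper filter rules out every other value.\<close>

lemma H_alg_eq_zero:
  assumes "has_Folner_sets G"
    and "\<And>\<epsilon>. \<epsilon> > 0 \<Longrightarrow>
      \<exists>E. left_tile G E \<and> ln (real (card (traj E X))) \<le> \<epsilon> * real (card E)"
    and "finite X" "X \<noteq> {}" "X \<subseteq> carrier A"
  shows "H_alg G A \<alpha> X = 0"
  unfolding H_alg_def
proof (rule the_equality)
  show "\<forall>(F :: 'g set \<Rightarrow> 'g set) \<Phi>. right_Folner_net G F \<Phi> \<longrightarrow>
      ((\<lambda>i. ln (real (card (traj (F i) X))) / real (card (F i))) \<longlongrightarrow> 0) \<Phi>"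
    using tendsto_zero_if_small_tiles[OF assms(2-)] by blast
next
  fix h assume h: "\<forall>(F :: 'g set \<Rightarrow> 'g set) \<Phi>. right_Folner_net G F \<Phi> \<longrightarrow>
      ((\<lambda>i. ln (real (card (traj (F i) X))) / real (card (F i))) \<longlongrightarrow> h) \<Phi>"
  obtain F :: "'g set \<Rightarrow> 'g set" and \<Phi> where net: "right_Folner_net G F \<Phi>"
    using G.Folner_net_exists[OF assms(1)] .
  moreover from this have "\<Phi> \<noteq> bot" by (simp add: right_Folner_net_def)
  ultimately show "h = 0"
    using h tendsto_zero_if_small_tiles[OF assms(2-) net] tendsto_unique by blast
qed

end

subsection \<open>Scalars with few subset sums\<close>

text \<open>In characteristic p this is the intersection of K with the field of p^m elements inside
  an algebraic closure, and for m = 1 the prime field. As a fixed-point set it needs no construction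
  of subfields: closure under addition is the freshman's dream.\<close>

definition Frobenius_fixed :: "nat \<Rightarrow> 'k::field set" where
  "Frobenius_fixed m = {x. x ^ (CHAR('k) ^ m) = x}"

definition prime_polys :: "'k::field poly set" where
  "prime_polys = {P. \<forall>i. coeff P i \<in> Frobenius_fixed 1}"

text \<open>The span of 1, t, ..., t^(d-1) over the prime field.\<close>

definition prime_span :: "'k::field \<Rightarrow> nat \<Rightarrow> 'k set" where
  "prime_span t d = (\<lambda>P. poly P t) ` {P \<in> prime_polys. \<forall>i\<ge>d. coeff P i = 0}"

context
  assumes char_prime: "prime CHAR('k::field)"
begin

section \<open>Finite subfields in characteristic p\<close>

lemma Frobenius_fixed_add:
  "x \<in> Frobenius_fixed m \<Longrightarrow> y \<in> Frobenius_fixed m \<Longrightarrow> x + y \<in> (Frobenius_fixed m :: 'k set)"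
  by (simp add: Frobenius_fixed_def freshmans_dream'[OF char_prime refl])

lemma Frobenius_fixed_0: "0 \<in> (Frobenius_fixed m :: 'k set)"
  using prime_gt_0_nat[OF char_prime] by (simp add: Frobenius_fixed_def)

lemma Frobenius_fixed_1: "1 \<in> (Frobenius_fixed m :: 'k set)"
  by (simp add: Frobenius_fixed_def)

lemma Frobenius_fixed_mult:
  "x \<in> Frobenius_fixed m \<Longrightarrow> y \<in> Frobenius_fixed m \<Longrightarrow> x * y \<in> (Frobenius_fixed m :: 'k set)"
  by (simp add: Frobenius_fixed_def power_mult_distrib)

lemma Frobenius_fixed_inverse:
  "x \<in> Frobenius_fixed m \<Longrightarrow> inverse x \<in> (Frobenius_fixed m :: 'k set)"
  by (simp add: Frobenius_fixed_def power_inverse)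

lemma Frobenius_fixed_uminus:
  assumes "x \<in> Frobenius_fixed m"
  shows "- x \<in> (Frobenius_fixed m :: 'k set)"
proof -
  have "x ^ (CHAR('k) ^ m) + (- x) ^ (CHAR('k) ^ m) = (x + - x) ^ (CHAR('k) ^ m)"
    by (rule freshmans_dream'[OF char_prime refl, symmetric])
  also have "\<dots> = 0" using prime_gt_0_nat[OF char_prime] by simp
  finally show ?thesis using assms by (simp add: Frobenius_fixed_def add_eq_0_iff)
qed

lemma Frobenius_fixed_sum:
  "(\<And>i. i \<in> I \<Longrightarrow> f i \<in> Frobenius_fixed m) \<Longrightarrow> sum f I \<in> (Frobenius_fixed m :: 'k set)"
  by (induction I rule: infinite_finite_induct) (auto intro: Frobenius_fixed_0 Frobenius_fixed_add)

lemma finite_Frobenius_fixed: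
  assumes "m > 0"
  shows "finite (Frobenius_fixed m :: 'k set)"
proof -
  let ?q = "CHAR('k) ^ m"
  have q: "?q > 1" using prime_gt_1_nat[OF char_prime] assms by (rule one_less_power)
  let ?P = "monom 1 ?q - monom 1 1 :: 'k poly"
  have "coeff ?P ?q = 1" using q by simp
  then have "?P \<noteq> 0" by (metis coeff_0 zero_neq_one)
  then have "finite {x. poly ?P x = 0}" by (rule poly_roots_finite)
  moreover have "Frobenius_fixed m = {x. poly ?P x = 0}"
    by (auto simp: Frobenius_fixed_def poly_monom)
  ultimately show ?thesis by simp
qed

lemma Frobenius_fixed_mono:
  assumes "m dvd m'"
  shows "Frobenius_fixed m \<subseteq> (Frobenius_fixed m' :: 'k set)"
proof
  fix x :: 'k assume x: "x \<in> Frobenius_fixed m"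
  obtain k where m': "m' = m * k" using assms by blast
  have "x ^ (CHAR('k) ^ (m * k)) = x"
  proof (induction k)
    case (Suc k)
    have "x ^ (CHAR('k) ^ (m * Suc k)) = (x ^ (CHAR('k) ^ (m * k))) ^ (CHAR('k) ^ m)"
      by (simp add: power_add mult.commute flip: power_mult)
    then show ?case using Suc x by (simp add: Frobenius_fixed_def)
  qed simp
  then show "x \<in> Frobenius_fixed m'" by (simp add: m' Frobenius_fixed_def)
qed

text \<open>The iterated p-th powers of \<open>x\<close> are powers of \<open>x\<close>, hence
  finitely many, so two of them agree; injectivity of the Frobenius map cancels the common
  part.\<close>

lemma finite_order_Frobenius_fixed:
  fixes x :: 'k
  assumes "x \<noteq> 0" "d > 0" "x ^ d = 1"
  obtains m where "m > 0" "x \<in> Frobenius_fixed m"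
proof -
  let ?p = "CHAR('k)"
  have p1: "?p > 1" using prime_gt_1_nat[OF char_prime] .
  have "\<not> inj_on (\<lambda>m. x ^ (?p ^ m)) UNIV"
  proof
    assume inj: "inj_on (\<lambda>m. x ^ (?p ^ m)) UNIV"
    have "range (\<lambda>m. x ^ (?p ^ m)) \<subseteq> (\<lambda>i. x ^ i) ` {..<d}"
    proof (intro subsetI, elim imageE)
      fix y m assume y: "y = x ^ (?p ^ m)"
      have "y = (x ^ d) ^ (?p ^ m div d) * x ^ (?p ^ m mod d)"
        unfolding y by (metis mult_div_mod_eq power_add power_mult)
      then show "y \<in> (\<lambda>i. x ^ i) ` {..<d}" using assms by auto
    qed
    then have "finite (range (\<lambda>m. x ^ (?p ^ m)))" by (rule finite_subset) simp
    then show False using finite_imageD[OF _ inj] by simp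
  qed
  then obtain i j where ij: "i < j" "x ^ (?p ^ i) = x ^ (?p ^ j)"
    by (metis inj_onI linorder_neqE_nat)
  \<comment> \<open>By additivity, y^(p^i) is the difference of the two equal powers, hence 0; a
    field has no nilpotents.\<close>
  define y where "y = x ^ (?p ^ (j - i)) - x"
  have "(y + x) ^ (?p ^ i) = y ^ (?p ^ i) + x ^ (?p ^ i)"
    by (rule freshmans_dream'[OF char_prime refl])
  moreover have "(y + x) ^ (?p ^ i) = x ^ (?p ^ j)"
    using ij(1) by (simp add: y_def flip: power_mult power_add)
  ultimately have "y ^ (?p ^ i) = 0" using ij(2) by simp
  then have "y = 0" by simp
  then have "x \<in> Frobenius_fixed (j - i)" by (simp add: y_def Frobenius_fixed_def)
  then show thesis using ij(1) that[of "j - i"] by simp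
qed

text \<open>Every element is fixed by some power of Frobenius. For a finite set \<open>Y\<close> the
  product of the exponents serves all elements at once, since fixed sets grow along
  divisibility.\<close>

lemma large_Frobenius_fixed:
  assumes inf: "infinite (UNIV :: 'k set)"
    and torsion: "\<And>x :: 'k. x \<noteq> 0 \<Longrightarrow> \<exists>d>0. x ^ d = 1"
  obtains m where "m > 0" "card (Frobenius_fixed m :: 'k set) \<ge> N"
proof -
  obtain Y :: "'k set" where Y: "finite Y" "card Y = N"
    using infinite_arbitrarily_large[OF inf] by blast
  have "\<exists>m>0. x \<in> Frobenius_fixed m" for x :: 'k
  proof (cases "x = 0")
    case True
    then show ?thesis using Frobenius_fixed_0 by blast
  next
    case False
    then show ?thesis using torsion finite_order_Frobenius_fixed by metis
  qed
  then obtain \<mu> where \<mu>: "\<And>x :: 'k. \<mu> x > 0 \<and> x \<in> Frobenius_fixed (\<mu> x)" by metis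
  define m where "m = prod \<mu> Y"
  have m: "m > 0" unfolding m_def using \<mu> Y by (simp add: prod_pos)
  have "Y \<subseteq> Frobenius_fixed m"
  proof
    fix x assume "x \<in> Y"
    then have "\<mu> x dvd m" unfolding m_def using Y by (intro dvd_prodI) auto
    then show "x \<in> Frobenius_fixed m" using Frobenius_fixed_mono \<mu> by blast
  qed
  then have "N \<le> card (Frobenius_fixed m :: 'k set)"
    using card_mono[OF finite_Frobenius_fixed[OF m]] Y by metis
  then show thesis using m that by blast
qed

section \<open>Polynomials over the prime field and their values at t\<close>

lemma prime_polys_add: "P \<in> prime_polys \<Longrightarrow> Q \<in> prime_polys \<Longrightarrow> P + Q \<in> (prime_polys :: 'k poly set)"
  by (simp add: prime_polys_def Frobenius_fixed_add)

lemma prime_polys_diff: "P \<in> prime_polys \<Longrightarrow> Q \<in> prime_polys \<Longrightarrow> P - Q \<in> (prime_polys :: 'k poly set)"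
  using Frobenius_fixed_add[OF _ Frobenius_fixed_uminus] by (simp add: prime_polys_def)

lemma prime_polys_smult: "c \<in> Frobenius_fixed 1 \<Longrightarrow> P \<in> prime_polys \<Longrightarrow> Polynomial.smult c P \<in> (prime_polys :: 'k poly set)"
  by (simp add: prime_polys_def Frobenius_fixed_mult)

lemma prime_polys_pCons: "c \<in> Frobenius_fixed 1 \<Longrightarrow> P \<in> prime_polys \<Longrightarrow> pCons c P \<in> (prime_polys :: 'k poly set)"
  by (simp add: prime_polys_def coeff_pCons split: nat.split)

lemma prime_polys_0: "0 \<in> (prime_polys :: 'k poly set)"
  by (simp add: prime_polys_def Frobenius_fixed_0)

lemma prime_polys_1: "1 \<in> (prime_polys :: 'k poly set)"
  unfolding one_pCons by (intro prime_polys_pCons Frobenius_fixed_1 prime_polys_0)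

lemma prime_polys_mult: "P \<in> prime_polys \<Longrightarrow> Q \<in> prime_polys \<Longrightarrow> P * Q \<in> (prime_polys :: 'k poly set)"
  by (simp add: prime_polys_def coeff_mult Frobenius_fixed_sum Frobenius_fixed_mult)

lemma prime_polys_power: "P \<in> prime_polys \<Longrightarrow> P ^ i \<in> (prime_polys :: 'k poly set)"
  by (induction i) (auto intro: prime_polys_1 prime_polys_mult)

lemma prime_polys_linear: "[:c, 1:] \<in> (prime_polys :: 'k poly set)" if "c \<in> {0, 1}"
  using that by (auto intro!: prime_polys_pCons Frobenius_fixed_0 Frobenius_fixed_1 prime_polys_0)

lemma prime_span_finite_card:
  "finite (prime_span (t :: 'k) d) \<and> card (prime_span t d) \<le> card (Frobenius_fixed 1 :: 'k set) ^ d"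
proof -
  let ?R = "{..<d} \<rightarrow>\<^sub>E (Frobenius_fixed 1 :: 'k set)"
  have fin: "finite ?R" by (intro finite_PiE finite_Frobenius_fixed) auto
  have "prime_span t d \<subseteq> (\<lambda>f. \<Sum>i<d. f i * t ^ i) ` ?R"
  proof
    fix y assume "y \<in> prime_span t d"
    then obtain P where P: "P \<in> prime_polys" "\<forall>i\<ge>d. coeff P i = 0" "y = poly P t"
      by (auto simp: prime_span_def)
    have "poly P t = (\<Sum>i\<le>degree P. coeff P i * t ^ i)" by (rule poly_altdef)
    also have "\<dots> = (\<Sum>i\<in>{..degree P} \<union> {..<d}. coeff P i * t ^ i)"
      by (intro sum.mono_neutral_left) (auto simp: coeff_eq_0)
    also have "\<dots> = (\<Sum>i<d. coeff P i * t ^ i)"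
      using P(2) by (intro sum.mono_neutral_right) auto
    also have "\<dots> = (\<Sum>i<d. restrict (coeff P) {..<d} i * t ^ i)" by simp
    finally show "y \<in> (\<lambda>f. \<Sum>i<d. f i * t ^ i) ` ?R"
      using P by (intro image_eqI[of _ _ "restrict (coeff P) {..<d}"]) (auto simp: prime_polys_def)
  qed
  then have "finite (prime_span t d)" "card (prime_span t d) \<le> card ?R"
    using fin by (auto intro: finite_subset surj_card_le)
  then show ?thesis by (simp add: card_PiE)
qed

lemma prime_span_add: "x \<in> prime_span (t :: 'k) d \<Longrightarrow> y \<in> prime_span t d \<Longrightarrow> x + y \<in> prime_span t d"
  unfolding prime_span_def by (auto simp flip: poly_add intro!: imageI prime_polys_add)

lemma prime_span_sum: "(\<And>i. i \<in> I \<Longrightarrow> f i \<in> prime_span (t :: 'k) d) \<Longrightarrow> sum f I \<in> prime_span t d"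
proof (induction I rule: infinite_finite_induct)
  have "0 \<in> prime_span t d"
    unfolding prime_span_def by (intro image_eqI[of _ _ 0]) (auto simp: prime_polys_0)
  then show "sum f {} \<in> prime_span t d" "infinite I \<Longrightarrow> sum f I \<in> prime_span t d" for I
    by simp_all
qed (auto intro: prime_span_add)

text \<open>Used in contrapositive form: an element of infinite order is transcendental over the
  prime field. Reduction modulo \<open>Q\<close> keeps all powers of \<open>t\<close> in the finite
  span of 1, ..., t^(d-1), so two powers coincide.\<close>

lemma algebraic_imp_finite_order:
  fixes t :: 'k
  assumes t: "t \<noteq> 0" and Q: "Q \<in> prime_polys" "Q \<noteq> 0" "poly Q t = 0"
  shows "\<exists>d>0. t ^ d = 1"
proof -
  define d where "d = degree Q"
  have d: "d > 0"
    using Q(2,3) unfolding d_def by (auto intro!: gr0I elim!: degree_eq_zeroE)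
  let ?l = "lead_coeff Q"
  have mult_t: "t * y \<in> prime_span t d" if "y \<in> prime_span t d" for y
  proof -
    obtain P where P: "P \<in> prime_polys" "\<forall>i\<ge>d. coeff P i = 0" "y = poly P t"
      using \<open>y \<in> prime_span t d\<close> by (auto simp: prime_span_def)
    \<comment> \<open>Chosen to cancel the coefficient of degree \<open>d\<close> in X P - c Q; as Q
      vanishes at \<open>t\<close>, the value at \<open>t\<close> is still t y.\<close>
    define c where "c = coeff P (d - 1) * inverse ?l"
    define P' where "P' = pCons 0 P - Polynomial.smult c Q"
    have "c \<in> Frobenius_fixed 1"
      using P(1) Q(1) by (auto simp: c_def prime_polys_def intro: Frobenius_fixed_mult Frobenius_fixed_inverse)
    then have "P' \<in> prime_polys"
      unfolding P'_def using P Q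
      by (intro prime_polys_diff prime_polys_smult prime_polys_pCons Frobenius_fixed_0)
    moreover have "coeff P' i = 0" if "i \<ge> d" for i
    proof (cases "i = d")
      case True
      have "coeff P' d = coeff P (d - 1) - c * ?l"
        using d by (simp add: P'_def coeff_pCons d_def split: nat.split)
      also have "c * ?l = coeff P (d - 1)" using Q(2) by (simp add: c_def)
      finally show ?thesis using True by simp
    next
      case False
      then show ?thesis using that P(2) d
        by (auto simp: P'_def coeff_pCons d_def coeff_eq_0 split: nat.split)
    qed
    moreover have "poly P' t = t * y" using Q(3) P(3) by (simp add: P'_def)
    ultimately show ?thesis unfolding prime_span_def by (intro image_eqI[of _ _ P']) auto
  qed
  have "t ^ m \<in> prime_span t d" for m
  proof (induction m)
    case 0
    show ?case unfolding prime_span_def using d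
      by (intro image_eqI[of _ _ 1]) (auto simp: prime_polys_1)
  qed (simp add: mult_t)
  then have "finite (range (\<lambda>m. t ^ m))"
    using prime_span_finite_card by (meson finite_subset image_subsetI)
  then have "\<not> inj (\<lambda>m. t ^ m)" using finite_imageD by blast
  then obtain i j where ij: "i < j" "t ^ i = t ^ j"
    by (metis inj_onI linorder_neqE_nat)
  then have "t ^ i * t ^ (j - i) = t ^ i * 1"
    by (metis le_add_diff_inverse less_imp_le mult_1_right power_add)
  then have "t ^ (j - i) = 1" using t by simp
  then show ?thesis using ij(1) by (intro exI[of _ "j - i"]) simp
qed

end

section \<open>Pairs of scalars generating a free abelian group of rank 2\<close>

definition mult_independent :: "'k::field \<Rightarrow> 'k \<Rightarrow> bool" where
  "mult_independent a b \<longleftrightarrow> a \<noteq> 0 \<and> b \<noteq> 0 \<and>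
     (\<forall>i j :: int. a powi i * b powi j = 1 \<longrightarrow> i = 0 \<and> j = 0)"

text \<open>Moving negative exponents across the equation leaves two shapes: equal signs give the
  first, opposite signs the second.\<close>

lemma mult_independentI:
  fixes a b :: "'k::field"
  assumes ab: "a \<noteq> 0" "b \<noteq> 0"
    and 1: "\<And>i j :: nat. a ^ i * b ^ j = 1 \<Longrightarrow> i = 0 \<and> j = 0"
    and 2: "\<And>i j :: nat. a ^ i = b ^ j \<Longrightarrow> i = 0 \<and> j = 0"
  shows "mult_independent a b"
  unfolding mult_independent_def
proof (intro conjI ab allI impI)
  fix i j :: int assume eq: "a powi i * b powi j = 1"
  obtain m n where mn: "i = int m \<or> i = - int m" "j = int n \<or> j = - int n"
    by (metis int_cases2)
  from mn eq have "a ^ m * b ^ n = 1 \<or> a ^ m = b ^ n"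
    using ab by (auto simp: power_int_minus field_simps)
  then have "m = 0 \<and> n = 0" using 1 2 by blast
  then show "i = 0" "j = 0" using mn by auto
qed

text \<open>The bound on the subset sums is exponential in \<open>L\<close> while there are \<open>L\<^sup>2\<close> monomials, so the tiles
  \<open>{a\<^sup>ib\<^sup>j | i, j < L}\<close> have small entropy.\<close>

definition small_subset_sums :: "'k::field \<Rightarrow> 'k \<Rightarrow> bool" where
  "small_subset_sums a b \<longleftrightarrow> (\<exists>C. \<forall>L. \<exists>S. finite S \<and> card S \<le> C ^ L \<and>
     (\<forall>Y \<subseteq> (\<lambda>(i, j). a ^ i * b ^ j) ` ({..<L} \<times> {..<L}). \<Sum>Y \<in> S))"

text \<open>K contains the natural numbers faithfully. Parity gives the independence of 2 and 3, and
  subset sums are counted by bounding them as integers.\<close>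

lemma char_0_box:
  assumes "CHAR('k::field) = 0"
  shows "mult_independent (2 :: 'k) 3 \<and> small_subset_sums (2 :: 'k) 3"
proof
  have inj: "(of_nat m :: 'k) = of_nat n \<longleftrightarrow> m = n" for m n
    using assms by (simp add: of_nat_eq_iff_cong_CHAR)
  show ind: "mult_independent (2 :: 'k) 3"
  proof (rule mult_independentI)
    show "(2 :: 'k) \<noteq> 0" "(3 :: 'k) \<noteq> 0" using inj[of 2 0] inj[of 3 0] by simp_all
  next
    fix i j :: nat assume "(2 :: 'k) ^ i * 3 ^ j = 1"
    then have "(of_nat (2 ^ i * 3 ^ j) :: 'k) = of_nat 1" by simp
    then have "(2 :: nat) ^ i * 3 ^ j = 1" unfolding inj .
    then show "i = 0 \<and> j = 0" by simp
  next
    fix i j :: nat assume "(2 :: 'k) ^ i = 3 ^ j"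
    then have "(of_nat (2 ^ i) :: 'k) = of_nat (3 ^ j)" by simp
    then have eq: "(2 :: nat) ^ i = 3 ^ j" unfolding inj .
    have "odd ((3 :: nat) ^ j)" by simp
    then have "i = 0" unfolding eq[symmetric] by (cases i) auto
    then show "i = 0 \<and> j = 0" using eq by (cases j) auto
  qed
  show "small_subset_sums (2 :: 'k) 3"
    unfolding small_subset_sums_def
  \<comment> \<open>6 = 2 * 3: all monomials together sum to less than 2^L * 3^L.\<close>
  proof (intro exI[of _ 6] allI)
    fix L :: nat
    let ?f = "\<lambda>(i, j). (2 :: 'k) ^ i * 3 ^ j" and ?g = "\<lambda>(i, j). (2 :: nat) ^ i * 3 ^ j"
    let ?B = "{..<L} \<times> {..<L}" and ?S = "of_nat ` {..<6 ^ L} :: 'k set"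
    have "\<Sum>Y \<in> ?S" if Y: "Y \<subseteq> ?f ` ?B" for Y
    proof -
      \<comment> \<open>Picking one exponent pair per element turns the sum over \<open>Y\<close>
        into an indexed sum that lifts to the natural numbers.\<close>
      have "\<exists>J. J \<subseteq> ?B \<and> inj_on ?f J \<and> Y = ?f ` J"
        using Y by (meson subset_image_inj)
      then obtain J where J: "J \<subseteq> ?B" "inj_on ?f J" "Y = ?f ` J" by blast
      have "\<Sum>Y = (\<Sum>x\<in>J. ?f x)" unfolding J(3) using J(2) by (simp add: sum.reindex)
      also have "\<dots> = of_nat (\<Sum>x\<in>J. ?g x)"
        by (simp add: case_prod_unfold)
      finally have *: "\<Sum>Y = of_nat (\<Sum>x\<in>J. ?g x)" .
      have pow: "(\<Sum>i<L. c ^ i) < c ^ L" if "c \<ge> 2" for c :: nat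
      proof (induction L)
        case (Suc L)
        have "2 * c ^ L \<le> c * c ^ L" using that by (intro mult_right_mono) auto
        then show ?case
          unfolding sum.lessThan_Suc power_Suc using Suc by linarith
      qed simp
      have "(\<Sum>x\<in>J. ?g x) \<le> (\<Sum>x\<in>?B. ?g x)"
        using J(1) by (intro sum_mono2) auto
      also have "\<dots> = (\<Sum>i<L. 2 ^ i) * (\<Sum>j<L. 3 ^ j)"
        by (simp add: sum_product sum.cartesian_product)
      also have "\<dots> < 2 ^ L * 3 ^ L"
        using pow[of 2] pow[of 3] by (intro mult_strict_mono) auto
      also have "\<dots> = 6 ^ L" by (simp flip: power_mult_distrib)
      finally show ?thesis unfolding * by (intro imageI) (simp only: lessThan_iff)
    qed
    moreover have "card ?S \<le> 6 ^ L"
      using card_image_le[of "{..<6 ^ L}" "of_nat :: nat \<Rightarrow> 'k"] by simp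
    ultimately show "\<exists>S. finite S \<and> card S \<le> 6 ^ L \<and> (\<forall>Y \<subseteq> ?f ` ?B. \<Sum>Y \<in> S)"
      by (intro exI[of _ ?S]) simp
  qed
qed

text \<open>As \<open>t\<close> is transcendental over the prime field, a relation between
  \<open>t\<close> and \<open>1 + t\<close> is an identity between X and X + 1, refuted by degrees
  or by roots. Subset sums are polynomials in \<open>t\<close> of bounded degree, hence few.\<close>

lemma char_p_box:
  fixes t :: "'k::field"
  assumes p: "prime CHAR('k)" and t: "t \<noteq> 0" "\<And>d. d > 0 \<Longrightarrow> t ^ d \<noteq> 1"
  shows "mult_independent t (1 + t) \<and> small_subset_sums t (1 + t)"
proof
  let ?x = "[:0, 1:] :: 'k poly" and ?y = "[:1, 1:] :: 'k poly"
  have xy: "?x ^ i * ?y ^ j \<in> prime_polys" "?x ^ i \<in> prime_polys" "?y ^ j \<in> prime_polys" for i j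
    by (intro prime_polys_mult[OF p] prime_polys_power[OF p] prime_polys_linear[OF p]; simp)+
  have no_root: "Q = 0" if "Q \<in> prime_polys" "poly Q t = 0" for Q
    using algebraic_imp_finite_order[OF p t(1) that(1)] that(2) t(2) by blast
  have deg: "degree (?x ^ i * ?y ^ j) = i + j" for i j
    by (simp add: degree_mult_eq degree_power_eq)
  show "mult_independent t (1 + t)"
  proof (rule mult_independentI)
    show "1 + t \<noteq> 0"
    proof
      assume "1 + t = 0"
      then have "t = -1" by (simp add: add_eq_0_iff)
      then show False using t(2)[of 2] by simp
    qed
  next
    fix i j :: nat assume "t ^ i * (1 + t) ^ j = 1"
    then have "?x ^ i * ?y ^ j - 1 = 0"
      by (intro no_root prime_polys_diff[OF p] xy prime_polys_1[OF p]) simp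
    then have "i + j = 0" using deg[of i j] by simp
    then show "i = 0 \<and> j = 0" by simp
  next
    fix i j :: nat assume "t ^ i = (1 + t) ^ j"
    then have "?x ^ i - ?y ^ j = 0"
      by (intro no_root prime_polys_diff[OF p] xy) simp
    then have eq: "?x ^ i = ?y ^ j" by simp
    \<comment> \<open>At 0 the identity forces i = 0; at -1, the root of X + 1, it then forces j =
      0.\<close>
    have "poly (?x ^ i) 0 = poly (?y ^ j) 0" "poly (?x ^ i) (-1) = poly (?y ^ j) (-1)"
      unfolding eq by (rule refl)+
    then have "(0 :: 'k) ^ i = 1" "(-1 :: 'k) ^ i = 0 ^ j" by simp_all
    then show "i = 0 \<and> j = 0" by (cases i; cases j) auto
  qed (rule t)
  let ?q = "card (Frobenius_fixed 1 :: 'k set)"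
  show "small_subset_sums t (1 + t)"
    unfolding small_subset_sums_def
  \<comment> \<open>The monomials have degree below 2L in \<open>t\<close>, and q^(2L) =
    (q^2)^L.\<close>
  proof (intro exI[of _ "?q ^ 2"] allI)
    fix L :: nat
    let ?f = "\<lambda>(i, j). t ^ i * (1 + t) ^ j" and ?B = "{..<L} \<times> {..<L}"
    have "?f x \<in> prime_span t (2 * L)" if "x \<in> ?B" for x
    proof -
      obtain i j where x: "x = (i, j)" "i < L" "j < L" using \<open>x \<in> ?B\<close> by auto
      have "coeff (?x ^ i * ?y ^ j) k = 0" if "k \<ge> 2 * L" for k
        using deg[of i j] x that by (intro coeff_eq_0) simp
      moreover have "poly (?x ^ i * ?y ^ j) t = ?f x" using x by simp
      ultimately show ?thesis
        unfolding prime_span_def using xy(1)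
        by (intro image_eqI[of _ _ "?x ^ i * ?y ^ j"]) auto
    qed
    then have "\<Sum>Y \<in> prime_span t (2 * L)" if "Y \<subseteq> ?f ` ?B" for Y
      using that by (intro prime_span_sum[OF p]) blast
    moreover have "finite (prime_span t (2 * L))" "card (prime_span t (2 * L)) \<le> (?q ^ 2) ^ L"
      using prime_span_finite_card[OF p, of t "2 * L"] by (auto simp: power_mult)
    ultimately show "\<exists>S. finite S \<and> card S \<le> (?q ^ 2) ^ L \<and> (\<forall>Y \<subseteq> ?f ` ?B. \<Sum>Y \<in> S)"
      by (intro exI[of _ "prime_span t (2 * L)"]) simp
  qed
qed

lemma field_cases:
  assumes "infinite (UNIV :: 'k::field set)"
  obtains
    (box) a b :: "'k::field" where "mult_independent a b" "small_subset_sums a b"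
  | (torsion) "prime CHAR('k::field)" "\<And>x :: 'k::field. x \<noteq> 0 \<Longrightarrow> \<exists>d>0. x ^ d = 1"
proof (cases "CHAR('k) = 0")
  case True
  then show thesis using char_0_box box by blast
next
  case False
  then have p: "prime CHAR('k)" by (intro prime_CHAR_semidom) simp
  show thesis
    using char_p_box[OF p] box torsion[OF p] by blast
qed

subsection \<open>Tilings of groups\<close>

text \<open>\<open>\<rho> g\<close> represents the coset gH. The last property is the disjointness
  clause that \<open>left_tile\<close> asks for.\<close>

lemma (in group) left_transversal:
  assumes "subgroup H G"
  obtains \<rho> where "\<And>g. g \<in> carrier G \<Longrightarrow> \<rho> g \<in> carrier G"
    "\<And>g. g \<in> carrier G \<Longrightarrow> inv (\<rho> g) \<otimes> g \<in> H"
    "\<And>g h. g \<in> carrier G \<Longrightarrow> h \<in> H \<Longrightarrow> \<rho> (\<rho> g \<otimes> h) = \<rho> g"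
proof -
  interpret H: subgroup H G by fact
  define \<rho> where "\<rho> g = (SOME x. x \<in> carrier G \<and> inv x \<otimes> g \<in> H)" for g
  have \<rho>: "\<rho> g \<in> carrier G \<and> inv (\<rho> g) \<otimes> g \<in> H" if "g \<in> carrier G" for g
    unfolding \<rho>_def by (rule someI[of _ g]) (use that in simp)
  \<comment> \<open>The predicates describing the representatives of \<open>g\<close> and of gh
    coincide, so the choice operator returns the same element.\<close>
  have iff: "inv x \<otimes> (g \<otimes> h) \<in> H \<longleftrightarrow> inv x \<otimes> g \<in> H"
    if "x \<in> carrier G" "g \<in> carrier G" "h \<in> H" for x g h
  proof
    assume "inv x \<otimes> (g \<otimes> h) \<in> H"
    then have "inv x \<otimes> (g \<otimes> h) \<otimes> inv h \<in> H"
      by (rule H.m_closed) (use that in simp)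
    then show "inv x \<otimes> g \<in> H" using that by (simp add: m_assoc)
  next
    assume "inv x \<otimes> g \<in> H"
    then have "inv x \<otimes> g \<otimes> h \<in> H" using that(3) by (rule H.m_closed)
    then show "inv x \<otimes> (g \<otimes> h) \<in> H" using that by (simp add: m_assoc)
  qed
  have coset: "\<rho> (g \<otimes> h) = \<rho> g" if "g \<in> carrier G" "h \<in> H" for g h
    unfolding \<rho>_def using iff that by (metis (no_types, opaque_lifting))
  have "\<rho> (\<rho> g \<otimes> h) = \<rho> g" if g: "g \<in> carrier G" and h: "h \<in> H" for g h
  proof -
    have "\<rho> g = \<rho> (\<rho> g \<otimes> (inv (\<rho> g) \<otimes> g))"
      using \<rho>[OF g] g by (simp flip: m_assoc)
    also have "\<dots> = \<rho> (\<rho> g)" using \<rho>[OF g] by (intro coset) auto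
    also have "\<dots> = \<rho> (\<rho> g \<otimes> h)" using \<rho>[OF g] h by (intro coset[symmetric]) auto
    finally show ?thesis by simp
  qed
  with \<rho> show thesis by (intro that[of \<rho>]) simp_all
qed

lemma (in group) left_tile_subgroup:
  assumes "subgroup H G" "finite H"
  shows "left_tile G H"
proof -
  obtain \<rho> where \<rho>: "\<And>g. g \<in> carrier G \<Longrightarrow> \<rho> g \<in> carrier G"
    "\<And>g. g \<in> carrier G \<Longrightarrow> inv (\<rho> g) \<otimes> g \<in> H"
    "\<And>g h. g \<in> carrier G \<Longrightarrow> h \<in> H \<Longrightarrow> \<rho> (\<rho> g \<otimes> h) = \<rho> g"
    using left_transversal[OF assms(1)] by blast
  have "g \<in> (\<lambda>h. \<rho> g \<otimes> h) ` H" if "g \<in> carrier G" for g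
    using \<rho>(1,2)[OF that] that
    by (intro image_eqI[of _ _ "inv (\<rho> g) \<otimes> g"]) (simp_all flip: m_assoc)
  moreover have "H \<noteq> {}" "H \<subseteq> carrier G"
    using subgroup.subset[OF assms(1)] subgroup.one_closed[OF assms(1)] by auto
  ultimately show ?thesis
    unfolding left_tile_def using assms(2) \<rho> by (intro conjI exI[of _ \<rho>]) simp_all
qed

text \<open>\<phi> embeds the lattice of integer pairs as a subgroup \<open>H\<close>. Division with
  remainder by \<open>L\<close> tiles the lattice by boxes, and coset representatives copy this
  tiling into every coset of \<open>H\<close>.\<close>

lemma (in group) left_tile_box:
  fixes \<phi> :: "int \<Rightarrow> int \<Rightarrow> 'a" and L :: nat
  assumes carr: "\<And>i j. \<phi> i j \<in> carrier G"
    and hom: "\<And>i j i' j'. \<phi> i j \<otimes> \<phi> i' j' = \<phi> (i + i') (j + j')"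
    and ker: "\<And>i j. \<phi> i j = \<one> \<Longrightarrow> i = 0 \<and> j = 0" and L: "L > 0"
  shows "left_tile G ((\<lambda>(i, j). \<phi> (int i) (int j)) ` ({..<L} \<times> {..<L}))"
proof -
  define H where "H = {\<phi> i j | i j. True}"
  let ?E = "(\<lambda>(i, j). \<phi> (int i) (int j)) ` ({..<L} \<times> {..<L})"
  have zero: "\<phi> 0 0 = \<one>"
    using hom[of 0 0 0 0] carr[of 0 0] by simp
  have inverse: "inv (\<phi> i j) = \<phi> (- i) (- j)" for i j
    by (rule inv_equality) (simp_all add: hom zero carr)
  have inj: "i = i' \<and> j = j'" if "\<phi> i j = \<phi> i' j'" for i j i' j'
  proof -
    have "\<phi> (i - i') (j - j') = \<phi> i j \<otimes> inv (\<phi> i' j')" by (simp add: inverse hom)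
    also have "\<dots> = \<one>" using that carr by simp
    finally show ?thesis using ker by fastforce
  qed
  have "subgroup H G"
  proof (rule subgroupI)
    show "H \<subseteq> carrier G" "H \<noteq> {}" using carr by (auto simp: H_def)
    show "inv x \<in> H" if "x \<in> H" for x using that inverse unfolding H_def by blast
    show "x \<otimes> y \<in> H" if "x \<in> H" "y \<in> H" for x y using that hom unfolding H_def by blast
  qed
  then obtain \<rho> where \<rho>: "\<And>g. g \<in> carrier G \<Longrightarrow> \<rho> g \<in> carrier G"
    "\<And>g. g \<in> carrier G \<Longrightarrow> inv (\<rho> g) \<otimes> g \<in> H"
    "\<And>g h. g \<in> carrier G \<Longrightarrow> h \<in> H \<Longrightarrow> \<rho> (\<rho> g \<otimes> h) = \<rho> g"
    using left_transversal by blast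
  define \<kappa> where "\<kappa> x = (SOME (i, j). x = \<phi> i j)" for x
  have \<kappa>: "\<kappa> (\<phi> i j) = (i, j)" for i j
    unfolding \<kappa>_def by (rule some_equality) (auto dest: inj)
  \<comment> \<open>Rounding both coordinates down to multiples of \<open>L\<close> gives the corner
    of the box containing \<open>x\<close>.\<close>
  define base where "base x = (case \<kappa> x of (i, j) \<Rightarrow> \<phi> (int L * (i div int L)) (int L * (j div int L)))" for x
  define \<beta> where "\<beta> g = \<rho> g \<otimes> base (inv (\<rho> g) \<otimes> g)" for g
  have "\<beta> g \<in> carrier G \<and> g \<in> (\<lambda>e. \<beta> g \<otimes> e) ` ?E \<and> (\<forall>e\<in>?E. \<beta> (\<beta> g \<otimes> e) = \<beta> g)"
    if g: "g \<in> carrier G" for g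
  proof -
    obtain i j where ij: "inv (\<rho> g) \<otimes> g = \<phi> i j" using \<rho>(2)[OF g] by (auto simp: H_def)
    define u v where "u = i div int L" and "v = j div int L"
    have \<beta>_eq: "\<beta> g = \<rho> g \<otimes> \<phi> (int L * u) (int L * v)"
      by (simp add: \<beta>_def ij base_def \<kappa> u_def v_def)
    have "g = \<rho> g \<otimes> \<phi> i j"
      unfolding ij[symmetric] using g \<rho>(1)[OF g] by (simp flip: m_assoc)
    also have "\<dots> = \<rho> g \<otimes> (\<phi> (int L * u) (int L * v) \<otimes> \<phi> (i mod int L) (j mod int L))"
      by (simp add: hom u_def v_def)
    also have "\<dots> = \<beta> g \<otimes> \<phi> (i mod int L) (j mod int L)"
      unfolding \<beta>_eq using \<rho>(1)[OF g] carr by (simp add: m_assoc)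
    finally have g_eq: "g = \<beta> g \<otimes> \<phi> (i mod int L) (j mod int L)" .
    have "\<phi> (i mod int L) (j mod int L) \<in> ?E"
      using L by (intro image_eqI[of _ _ "(nat (i mod int L), nat (j mod int L))"])
        (auto simp: nat_less_iff)
    then have "g \<in> (\<lambda>e. \<beta> g \<otimes> e) ` ?E" using g_eq by blast
    moreover have "\<beta> (\<beta> g \<otimes> e) = \<beta> g" if "e \<in> ?E" for e
    proof -
      obtain r s where rs: "r < L" "s < L" "e = \<phi> (int r) (int s)" using \<open>e \<in> ?E\<close> by auto
      define h where "h = \<phi> (int L * u + int r) (int L * v + int s)"
      have "h \<in> H" by (auto simp: H_def h_def)
      have \<beta>e: "\<beta> g \<otimes> e = \<rho> g \<otimes> h"
        unfolding \<beta>_eq rs h_def using \<rho>(1)[OF g] carr by (simp add: m_assoc hom)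
      have "\<rho> (\<rho> g \<otimes> h) = \<rho> g" using \<rho>(3)[OF g \<open>h \<in> H\<close>] .
      moreover have "inv (\<rho> g) \<otimes> (\<rho> g \<otimes> h) = h"
        using \<rho>(1)[OF g] carr by (simp add: h_def flip: m_assoc)
      moreover have "base h = \<phi> (int L * u) (int L * v)"
        using rs by (simp add: base_def h_def \<kappa>)
      ultimately show ?thesis unfolding \<beta>e by (simp add: \<beta>_def[of "\<rho> g \<otimes> h"] \<beta>_eq)
    qed
    ultimately show ?thesis using \<beta>_eq \<rho>(1)[OF g] carr by simp
  qed
  then have "\<forall>g\<in>carrier G. \<beta> g \<in> carrier G \<and> g \<in> (\<lambda>e. \<beta> g \<otimes> e) ` ?E \<and>
      (\<forall>e\<in>?E. \<beta> (\<beta> g \<otimes> e) = \<beta> g)" by blast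
  moreover have "finite ?E" "?E \<noteq> {}" "?E \<subseteq> carrier G" using carr L by auto
  ultimately show ?thesis unfolding left_tile_def by (intro conjI exI[of _ \<beta>])
qed

subsection \<open>The upper triangular group\<close>

abbreviation UT :: "'k::field itself \<Rightarrow> nat \<Rightarrow> 'k mat monoid" where
  "UT \<equiv> upper_triangular_group"

lemma UT_simps:
  "mult (UT ty n) = (*)" "one (UT ty n) = 1\<^sub>m n"
  "carrier (UT ty n) = {M \<in> Units (ring_mat ty n ()). upper_triangular M}"
  by (simp_all add: upper_triangular_group_def GL_group_simps)

lemma group_UT: "group (UT TYPE('k::field) n)"
proof -
  have "group ((GL_group TYPE('k) n)\<lparr>carrier := carrier (UT TYPE('k) n)\<rparr>)"
    by (rule group.subgroup_imp_group[OF group_GL_group subgroup_upper_triangular])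
  then show ?thesis by (simp add: upper_triangular_group_def)
qed

lemma UT_carrier_mat: "M \<in> carrier (UT TYPE('k::field) n) \<Longrightarrow> M \<in> carrier_mat n n"
  by (auto simp: UT_simps Units_def ring_mat_def)

lemma UT_diag_nonzero:
  assumes M: "M \<in> carrier (UT TYPE('k::field) n)" and i: "i < n"
  shows "M $$ (i, i) \<noteq> 0"
proof -
  obtain N where N: "N \<in> carrier_mat n n" "M * N = 1\<^sub>m n"
    using M by (auto simp: UT_simps Units_def ring_mat_def)
  have Mc: "M \<in> carrier_mat n n" using UT_carrier_mat[OF M] .
  have "det M * det N = 1" using det_mult[OF Mc N(1)] N(2) by simp
  then have "det M \<noteq> 0" by auto
  moreover have "upper_triangular M" using M by (simp add: UT_simps)
  ultimately show ?thesis
    using upper_triangular_imp_det_eq_0_iff[OF Mc] i Mc by (auto simp: diag_mat_def)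
qed

text \<open>Step 0 is the whole group, step 1 the unitriangular group, step n trivial.\<close>

definition UT_filtration :: "'k::field itself \<Rightarrow> nat \<Rightarrow> nat \<Rightarrow> 'k mat set" where
  "UT_filtration ty n k = {M \<in> carrier (UT ty n).
     \<forall>i<n. \<forall>j<n. j < i + k \<longrightarrow> M $$ (i, j) = (if i = j then 1 else 0)}"

text \<open>Outside the matrix the values are the neutral element of the target group:
  multiplicative for k = 0, additive otherwise.\<close>

definition superdiagonal :: "nat \<Rightarrow> nat \<Rightarrow> 'k::field mat \<Rightarrow> nat \<Rightarrow> 'k" where
  "superdiagonal n k M = (\<lambda>i. if i + k < n then M $$ (i, i + k) else if k = 0 then 1 else 0)"

definition nonzero_functions :: "(nat \<Rightarrow> 'k::field) monoid" where
  "nonzero_functions = \<lparr>carrier = {f. \<forall>i. f i \<noteq> 0}, monoid.mult = (\<lambda>f g i. f i * g i), one = (\<lambda>_. 1)\<rparr>"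

definition additive_functions :: "(nat \<Rightarrow> 'k::field) monoid" where
  "additive_functions = \<lparr>carrier = UNIV, monoid.mult = (\<lambda>f g i. f i + g i), one = (\<lambda>_. 0)\<rparr>"

lemma comm_group_nonzero_functions: "comm_group (nonzero_functions :: (nat \<Rightarrow> 'k::field) monoid)"
proof (rule comm_groupI)
  fix f :: "nat \<Rightarrow> 'k::field" assume "f \<in> carrier nonzero_functions"
  then show "\<exists>g\<in>carrier nonzero_functions.
      g \<otimes>\<^bsub>nonzero_functions\<^esub> f = \<one>\<^bsub>nonzero_functions\<^esub>"
    by (intro bexI[of _ "\<lambda>i. inverse (f i)"]) (auto simp: nonzero_functions_def)
qed (auto simp: nonzero_functions_def mult_ac)

lemma comm_group_additive_functions: "comm_group (additive_functions :: (nat \<Rightarrow> 'k::field) monoid)"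
proof (rule comm_groupI)
  fix f :: "nat \<Rightarrow> 'k::field"
  show "\<exists>g\<in>carrier additive_functions.
      g \<otimes>\<^bsub>additive_functions\<^esub> f = \<one>\<^bsub>additive_functions\<^esub>"
    by (intro bexI[of _ "\<lambda>i. - f i"]) (auto simp: additive_functions_def)
qed (auto simp: additive_functions_def add_ac)

lemma UT_filtrationD:
  assumes "M \<in> UT_filtration TYPE('k::field) n k" "i < n" "j < n" "j < i + k"
  shows "M $$ (i, j) = (if i = j then 1 else 0)"
  using assms by (simp add: UT_filtration_def)

lemma UT_filtration_lower:
  assumes "M \<in> UT_filtration TYPE('k::field) n k" "i < n" "j < i"
  shows "M $$ (i, j) = 0"
  using assms UT_carrier_mat[of M n] by (auto simp: UT_filtration_def UT_simps)

text \<open>In the matrix product only the indices i and i + k contribute: before i + k the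
  filtration kills the entry of \<open>M\<close>, after it triangularity kills that of
  \<open>N\<close>. For k = 0 the two coincide; otherwise the diagonal entries are 1.\<close>

lemma superdiagonal_mult:
  assumes M: "M \<in> UT_filtration TYPE('k::field) n k" and N: "N \<in> UT_filtration TYPE('k) n k"
    and i: "i + k < n"
  shows "(M * N) $$ (i, i + k) =
    (if k = 0 then M $$ (i, i) * N $$ (i, i) else M $$ (i, i + k) + N $$ (i, i + k))"
proof -
  have carr: "M \<in> carrier_mat n n" "N \<in> carrier_mat n n"
    using M N UT_carrier_mat by (auto simp: UT_filtration_def)
  have zero: "M $$ (i, l) * N $$ (l, i + k) = 0" if "l < n" "l \<noteq> i" "l \<noteq> i + k" for l
  proof (cases "l < i + k")
    case True
    then have "M $$ (i, l) = 0" using UT_filtrationD[OF M, of i l] that i by simp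
    then show ?thesis by simp
  next
    case False
    then have "N $$ (l, i + k) = 0" using UT_filtration_lower[OF N, of l "i + k"] that i by simp
    then show ?thesis by simp
  qed
  have "(M * N) $$ (i, i + k) = (\<Sum>l\<in>{0..<n}. M $$ (i, l) * N $$ (l, i + k))"
    using carr i by (simp add: scalar_prod_def)
  also have "\<dots> = (\<Sum>l\<in>{i, i + k}. M $$ (i, l) * N $$ (l, i + k))"
    using zero i by (intro sum.mono_neutral_right) auto
  also have "\<dots> = (if k = 0 then M $$ (i, i) * N $$ (i, i) else M $$ (i, i + k) + N $$ (i, i + k))"
    using UT_filtrationD[OF M, of i i] UT_filtrationD[OF N, of "i + k" "i + k"] i by auto
  finally show ?thesis .
qed

text \<open>The subgroup property is a hypothesis because that of the next step is itself obtained
  from this lemma, as a kernel.\<close>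

lemma UT_filtration_step:
  assumes sub: "subgroup (UT_filtration TYPE('k::field) n k) (UT TYPE('k) n)"
  obtains Q :: "(nat \<Rightarrow> 'k::field) monoid" and h where "comm_group Q"
    "group_hom ((UT TYPE('k) n)\<lparr>carrier := UT_filtration TYPE('k) n k\<rparr>) Q h"
    "kernel ((UT TYPE('k) n)\<lparr>carrier := UT_filtration TYPE('k) n k\<rparr>) Q h = UT_filtration TYPE('k) n (Suc k)"
proof -
  let ?P = "(UT TYPE('k) n)\<lparr>carrier := UT_filtration TYPE('k) n k\<rparr>"
  define Q :: "(nat \<Rightarrow> 'k::field) monoid" where "Q = (if k = 0 then nonzero_functions else additive_functions)"
  have Q: "comm_group Q"
    by (simp add: Q_def comm_group_nonzero_functions comm_group_additive_functions)
  have P: "group ?P" by (rule group.subgroup_imp_group[OF group_UT sub])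
  have "superdiagonal n k \<in> hom ?P Q"
  proof (rule homI)
    fix M assume "M \<in> carrier ?P"
    then show "superdiagonal n k M \<in> carrier Q"
      using UT_diag_nonzero[of M n]
      by (auto simp: Q_def nonzero_functions_def additive_functions_def superdiagonal_def UT_filtration_def)
  next
    fix M N assume "M \<in> carrier ?P" "N \<in> carrier ?P"
    then show "superdiagonal n k (M \<otimes>\<^bsub>?P\<^esub> N) = superdiagonal n k M \<otimes>\<^bsub>Q\<^esub> superdiagonal n k N"
      using superdiagonal_mult[of M n k N]
      by (auto simp: Q_def nonzero_functions_def additive_functions_def superdiagonal_def UT_simps fun_eq_iff)
  qed
  then have hom: "group_hom ?P Q (superdiagonal n k)"
    using P Q by (simp add: group_hom_def group_hom_axioms_def comm_group.axioms)
  have "kernel ?P Q (superdiagonal n k) = UT_filtration TYPE('k) n (Suc k)"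
  proof (rule Set.set_eqI)
    fix M
    have "M \<in> kernel ?P Q (superdiagonal n k) \<longleftrightarrow>
        M \<in> UT_filtration TYPE('k) n k \<and> (\<forall>i. i + k < n \<longrightarrow> M $$ (i, i + k) = (if k = 0 then 1 else 0))"
      by (auto simp: kernel_def Q_def nonzero_functions_def additive_functions_def superdiagonal_def fun_eq_iff)
    also have "\<dots> \<longleftrightarrow> M \<in> UT_filtration TYPE('k) n (Suc k)"
    proof
      assume M: "M \<in> UT_filtration TYPE('k) n (Suc k)"
      then have "M \<in> UT_filtration TYPE('k) n k" by (auto simp: UT_filtration_def)
      moreover have "M $$ (i, i + k) = (if k = 0 then 1 else 0)" if "i + k < n" for i
        using UT_filtrationD[OF M, of i "i + k"] that by simp
      ultimately show "M \<in> UT_filtration TYPE('k) n k \<and>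
          (\<forall>i. i + k < n \<longrightarrow> M $$ (i, i + k) = (if k = 0 then 1 else 0))" by blast
    qed (auto simp: UT_filtration_def less_Suc_eq)
    finally show "M \<in> kernel ?P Q (superdiagonal n k) \<longleftrightarrow> M \<in> UT_filtration TYPE('k) n (Suc k)" .
  qed
  with Q hom show thesis by (rule that)
qed

lemma UT_filtration_0: "UT_filtration TYPE('k::field) n 0 = carrier (UT TYPE('k) n)"
proof -
  have "M $$ (i, j) = 0" if "M \<in> carrier (UT TYPE('k) n)" "j < i" "i < n" for M i j
    using that UT_carrier_mat[OF that(1)] by (auto simp: UT_simps)
  then show ?thesis by (auto simp: UT_filtration_def)
qed

lemma subgroup_UT_filtration: "subgroup (UT_filtration TYPE('k::field) n k) (UT TYPE('k) n)"
proof (induction k)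
  case 0
  then show ?case unfolding UT_filtration_0 by (rule group.subgroup_self[OF group_UT])
next
  case (Suc k)
  obtain Q :: "(nat \<Rightarrow> 'k::field) monoid" and h where
    *: "group_hom ((UT TYPE('k) n)\<lparr>carrier := UT_filtration TYPE('k) n k\<rparr>) Q h"
    "kernel ((UT TYPE('k) n)\<lparr>carrier := UT_filtration TYPE('k) n k\<rparr>) Q h = UT_filtration TYPE('k) n (Suc k)"
    using UT_filtration_step[OF Suc] by blast
  show ?case
    using group.incl_subgroup[OF group_UT Suc] group_hom.subgroup_kernel[OF *(1)] unfolding *(2) by blast
qed

text \<open>Induction downwards from the trivial group at step n, each step being an extension with
  abelian quotient.\<close>

lemma has_Folner_sets_UT: "has_Folner_sets (UT TYPE('k::field) n)"
proof -
  have "has_Folner_sets ((UT TYPE('k) n)\<lparr>carrier := UT_filtration TYPE('k) n k\<rparr>)" if "k \<le> n" for k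
    using that
  proof (induction k rule: inc_induct)
    case base
    have "M = 1\<^sub>m n" if "M \<in> UT_filtration TYPE('k) n n" for M
      using that UT_carrier_mat[of M n] by (intro eq_matI) (auto simp: UT_filtration_def)
    moreover have "1\<^sub>m n \<in> UT_filtration TYPE('k) n n"
      using subgroup.one_closed[OF subgroup_UT_filtration[of n n, where 'k = 'k]] by (simp add: UT_simps)
    ultimately have eq: "UT_filtration TYPE('k) n n = {1\<^sub>m n}" by blast
    show ?case
      unfolding has_Folner_sets_def eq
      by (auto simp: r_coset_def UT_simps intro!: exI[of _ "{1\<^sub>m n}"])
  next
    case (step k)
    obtain Q :: "(nat \<Rightarrow> 'k::field) monoid" and h where "comm_group Q" and
      *: "group_hom ((UT TYPE('k) n)\<lparr>carrier := UT_filtration TYPE('k) n k\<rparr>) Q h"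
      "kernel ((UT TYPE('k) n)\<lparr>carrier := UT_filtration TYPE('k) n k\<rparr>) Q h = UT_filtration TYPE('k) n (Suc k)"
      using UT_filtration_step[OF subgroup_UT_filtration] by blast
    then show ?case
      using group_hom.has_Folner_sets_comm_extension[OF *(1) \<open>comm_group Q\<close>] step.IH by simp
  qed
  from this[of 0] show ?thesis by (simp add: UT_filtration_0)
qed

section \<open>Scalar matrices and their trajectories\<close>

abbreviation scalar_mat :: "nat \<Rightarrow> 'k::field \<Rightarrow> 'k mat" where
  "scalar_mat n c \<equiv> c \<cdot>\<^sub>m 1\<^sub>m n"

lemma scalar_mat_mult: "scalar_mat n c * scalar_mat n d = scalar_mat n (c * d :: 'k::field)"
proof -
  have "scalar_mat n c * scalar_mat n d = c \<cdot>\<^sub>m (1\<^sub>m n * scalar_mat n d)"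
    by (rule mult_smult_assoc_mat) auto
  also have "\<dots> = scalar_mat n (c * d)" by (intro eq_matI) auto
  finally show ?thesis .
qed

lemma scalar_mat_inj:
  assumes "n \<ge> 1" "scalar_mat n c = scalar_mat n (d :: 'k::field)"
  shows "c = d"
proof -
  have "scalar_mat n c $$ (0, 0) = scalar_mat n d $$ (0, 0)" using assms(2) by simp
  then show ?thesis using assms(1) by simp
qed

lemma scalar_mat_in_UT:
  assumes "c \<noteq> (0 :: 'k::field)"
  shows "scalar_mat n c \<in> carrier (UT TYPE('k) n)"
proof -
  have "scalar_mat n c * scalar_mat n (inverse c) = 1\<^sub>m n" "scalar_mat n (inverse c) * scalar_mat n c = 1\<^sub>m n"
    using assms by (simp_all add: scalar_mat_mult) auto
  then show ?thesis
    by (auto simp: UT_simps Units_def ring_mat_def upper_triangular_def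
        intro!: bexI[of _ "scalar_mat n (inverse c)"])
qed

lemma natural_action_scalar_mat:
  fixes c :: "'k::field"
  assumes "v \<in> carrier_vec n"
  shows "natural_action n (scalar_mat n c) v = c \<cdot>\<^sub>v v"
  using assms by (intro eq_vecI) (auto simp: natural_action_def)

lemma automorphism_action_UT:
  "automorphism_action (UT TYPE('k::field) n) (monoid_vec TYPE('k) n) (natural_action n)"
  by (intro automorphism_action.intro automorphism_action_axioms.intro group_UT comm_group_vec
      natural_action_by_automorphisms)

text \<open>Grouping the summands \<open>c x\<^sub>c\<close> by the value of \<open>x\<^sub>c\<close> writes an element of the trajectory as
  a combination of the elements of \<open>X\<close> whose coefficients are subset sums of \<open>E\<close>.\<close>

lemma card_traj_scalars:
  fixes E S :: "'k::field set"
  assumes E: "finite E" "n \<ge> 1" and S: "finite S" "\<And>Y. Y \<subseteq> E \<Longrightarrow> \<Sum>Y \<in> S"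
    and X: "finite X" "X \<subseteq> carrier_vec n"
  shows "card (alg_trajectory (monoid_vec TYPE('k) n) (natural_action n) (scalar_mat n ` E) X)
    \<le> card S ^ card X"
proof -
  let ?V = "monoid_vec TYPE('k) n"
  let ?comb = "\<lambda>s. vec n (\<lambda>i. \<Sum>x\<in>X. s x * x $ i)"
  interpret V: comm_group ?V by (rule comm_group_vec)
  have inj: "inj_on (scalar_mat n) E"
    using scalar_mat_inj[OF E(2)] by (auto simp: inj_on_def)
  have "alg_trajectory ?V (natural_action n) (scalar_mat n ` E) X \<subseteq> ?comb ` (X \<rightarrow>\<^sub>E S)"
  proof
    fix z assume "z \<in> alg_trajectory ?V (natural_action n) (scalar_mat n ` E) X"
    then obtain y where y: "z = finprod ?V y (scalar_mat n ` E)"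
      "\<forall>c\<in>E. y (scalar_mat n c) \<in> natural_action n (scalar_mat n c) ` X"
      by (auto simp: alg_trajectory_def)
    have "\<forall>c\<in>E. \<exists>x\<in>X. y (scalar_mat n c) = c \<cdot>\<^sub>v x"
    proof
      fix c assume "c \<in> E"
      then obtain v where "v \<in> X" "y (scalar_mat n c) = natural_action n (scalar_mat n c) v"
        using y(2) by auto
      then show "\<exists>x\<in>X. y (scalar_mat n c) = c \<cdot>\<^sub>v x"
        using X natural_action_scalar_mat[of v n c] by auto
    qed
    then obtain x where x: "\<And>c. c \<in> E \<Longrightarrow> x c \<in> X"
      "\<And>c. c \<in> E \<Longrightarrow> y (scalar_mat n c) = c \<cdot>\<^sub>v x c"
      by metis
    have xc: "x c \<in> carrier_vec n" if "c \<in> E" for c using x(1)[OF that] X by auto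
    have "z = finprod ?V (\<lambda>c. y (scalar_mat n c)) E"
      unfolding y(1) using inj x(2) xc by (intro V.finprod_reindex) (auto simp: monoid_vec_simps)
    also have "\<dots> = finsum_vec TYPE('k) n (\<lambda>c. c \<cdot>\<^sub>v x c) E"
      unfolding finsum_vec_def
      using x(2) xc by (intro V.finprod_cong') (auto simp: monoid_vec_simps)
    finally have z: "z = finsum_vec TYPE('k) n (\<lambda>c. c \<cdot>\<^sub>v x c) E" .
    have zc: "z \<in> carrier_vec n"
      unfolding z using xc by (intro finsum_vec_closed) auto
    define s where "s = (\<lambda>v\<in>X. \<Sum>{c \<in> E. x c = v})"
    have "z = ?comb s"
    proof (rule eq_vecI)
      fix i assume "i < dim_vec (?comb s)"
      then have i: "i < n" by simp
      have "z $ i = (\<Sum>c\<in>E. (c \<cdot>\<^sub>v x c) $ i)"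
        unfolding z using E i xc by (intro index_finsum_vec) auto
      also have "\<dots> = (\<Sum>c\<in>E. c * x c $ i)"
        using xc[THEN carrier_vecD] i by (intro sum.cong) auto
      also have "\<dots> = (\<Sum>v\<in>X. \<Sum>c\<in>{c \<in> E. x c = v}. c * x c $ i)"
        using E X x(1) by (intro sum.group[symmetric]) auto
      also have "\<dots> = (\<Sum>v\<in>X. s v * v $ i)"
        by (intro sum.cong) (auto simp: s_def sum_distrib_right)
      finally show "z $ i = ?comb s $ i" using i by simp
    qed (use zc in simp)
    moreover have "s \<in> X \<rightarrow>\<^sub>E S" using S(2) by (auto simp: s_def)
    ultimately show "z \<in> ?comb ` (X \<rightarrow>\<^sub>E S)" by blast
  qed
  then have "card (alg_trajectory ?V (natural_action n) (scalar_mat n ` E) X) \<le> card (X \<rightarrow>\<^sub>E S)"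
    using X S by (intro surj_card_le finite_PiE) auto
  then show ?thesis using X by (simp add: card_PiE)
qed

lemma ln_card_traj_scalars:
  fixes E S :: "'k::field set"
  assumes E: "finite E" "0 \<notin> E" "n \<ge> 1" and S: "finite S" "\<And>Y. Y \<subseteq> E \<Longrightarrow> \<Sum>Y \<in> S"
    and X: "finite X" "X \<noteq> {}" "X \<subseteq> carrier_vec n"
  shows "ln (real (card (alg_trajectory (monoid_vec TYPE('k) n) (natural_action n) (scalar_mat n ` E) X)))
    \<le> real (card X) * ln (real (card S))"
proof -
  interpret automorphism_action "UT TYPE('k) n" "monoid_vec TYPE('k) n" "natural_action n"
    by (rule automorphism_action_UT)
  have "scalar_mat n ` E \<subseteq> carrier (UT TYPE('k) n)"
    using scalar_mat_in_UT E(2) by (metis image_subsetI)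
  then have pos: "card (traj (scalar_mat n ` E) X) > 0"
    using E X by (intro card_traj_pos) (auto simp: monoid_vec_simps)
  have "S \<noteq> {}" using S(2)[of "{}"] by auto
  then have S0: "card S > 0" using S by (simp add: card_gt_0_iff)
  have "real (card (traj (scalar_mat n ` E) X)) \<le> real (card S) ^ card X"
    using card_traj_scalars[OF E(1,3) S X(1,3)] by (metis of_nat_le_iff of_nat_power)
  then have "ln (real (card (traj (scalar_mat n ` E) X))) \<le> ln (real (card S) ^ card X)"
    using pos S0 by (subst ln_le_cancel_iff) auto
  then show ?thesis using S0 by (simp add: ln_realpow)
qed

text \<open>With L chosen so that |X| log C is at most \<epsilon> L, the bound |X| log|S| is at most
  |X| L log C, hence at most \<epsilon> L^2, and L^2 is the size of the tile.\<close>

lemma small_tile_box: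
  fixes a b :: "'k::field"
  assumes ind: "mult_independent a b" and small: "small_subset_sums a b" and n: "n \<ge> 1"
    and X: "finite X" "X \<noteq> {}" "X \<subseteq> carrier_vec n" and \<epsilon>: "\<epsilon> > 0"
  shows "\<exists>E. left_tile (UT TYPE('k) n) E \<and>
    ln (real (card (alg_trajectory (monoid_vec TYPE('k) n) (natural_action n) E X))) \<le> \<epsilon> * real (card E)"
proof -
  obtain C where C: "\<And>L. \<exists>S. finite S \<and> card S \<le> C ^ L \<and>
     (\<forall>Y \<subseteq> (\<lambda>(i, j). a ^ i * b ^ j) ` ({..<L} \<times> {..<L}). \<Sum>Y \<in> S)"
    using small unfolding small_subset_sums_def by blast
  obtain L0 :: nat where L0: "real (card X) * ln (real C) / \<epsilon> \<le> real L0"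
    using real_arch_simple by blast
  define L where "L = Suc L0"
  have L: "L > 0" "real (card X) * ln (real C) \<le> \<epsilon> * real L"
    using L0 \<epsilon> by (auto simp: L_def field_simps)
  let ?B = "{..<L} \<times> {..<L}"
  define E where "E = (\<lambda>(i, j). a ^ i * b ^ j) ` ?B"
  obtain S where S: "finite S" "card S \<le> C ^ L" "\<And>Y. Y \<subseteq> E \<Longrightarrow> \<Sum>Y \<in> S"
    using C[of L] unfolding E_def by blast
  have ab: "a \<noteq> 0" "b \<noteq> 0" and
    ker: "\<And>i j :: int. a powi i * b powi j = 1 \<Longrightarrow> i = 0 \<and> j = 0"
    using ind by (auto simp: mult_independent_def)
  have E: "finite E" "0 \<notin> E" using ab by (auto simp: E_def)
  have "S \<noteq> {}" using S(3)[of "{}"] by auto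
  then have S0: "card S > 0" using S(1) by (simp add: card_gt_0_iff)
  \<comment> \<open>L > 0 matters: for L = 0 the bound C^L is 1 even when C = 0.\<close>
  then have C0: "C > 0" using S(2) L(1) by (cases "C = 0") (auto simp: zero_power)
  define \<phi> where "\<phi> i j = scalar_mat n (a powi i * b powi j)" for i j
  interpret G: group "UT TYPE('k) n" by (rule group_UT)
  have "left_tile (UT TYPE('k) n) ((\<lambda>(i, j). \<phi> (int i) (int j)) ` ?B)"
  proof (rule G.left_tile_box)
    show "\<phi> i j \<in> carrier (UT TYPE('k) n)" for i j
      unfolding \<phi>_def using ab by (intro scalar_mat_in_UT) simp
    show "\<phi> i j \<otimes>\<^bsub>UT TYPE('k) n\<^esub> \<phi> i' j' = \<phi> (i + i') (j + j')" for i j i' j'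
      using ab by (simp add: \<phi>_def UT_simps scalar_mat_mult power_int_add mult_ac)
    show "i = 0 \<and> j = 0" if "\<phi> i j = \<one>\<^bsub>UT TYPE('k) n\<^esub>" for i j
    proof -
      have "1\<^sub>m n = scalar_mat n (1 :: 'k)" by auto
      then have "scalar_mat n (a powi i * b powi j) = scalar_mat n 1"
        using that by (simp add: \<phi>_def UT_simps)
      then show ?thesis using scalar_mat_inj[OF n] ker by blast
    qed
  qed (rule L)
  moreover have "(\<lambda>(i, j). \<phi> (int i) (int j)) ` ?B = scalar_mat n ` E"
    by (auto simp: E_def \<phi>_def image_image case_prod_unfold)
  ultimately have tile: "left_tile (UT TYPE('k) n) (scalar_mat n ` E)" by simp
  have "inj_on (\<lambda>(i, j). a ^ i * b ^ j) ?B"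
  proof (rule inj_onI, clarify)
    fix i j i' j' assume eq: "a ^ i * b ^ j = a ^ i' * b ^ j'"
    have "a powi (int i - int i') * b powi (int j - int j') = 1"
      using ab eq by (simp add: power_int_diff field_simps)
    then show "i = i' \<and> j = j'" using ker by force
  qed
  then have "card E = L * L" by (simp add: E_def card_image card_cartesian_product)
  moreover have "inj_on (scalar_mat n) E"
    using scalar_mat_inj[OF n] by (auto simp: inj_on_def)
  ultimately have cardE: "card (scalar_mat n ` E) = L * L" by (simp add: card_image)
  have "real (card S) \<le> real C ^ L" using S(2) by (metis of_nat_le_iff of_nat_power)
  then have "ln (real (card S)) \<le> ln (real C ^ L)"
    using S0 C0 by (subst ln_le_cancel_iff) auto
  also have "\<dots> = real L * ln (real C)" using C0 by (simp add: ln_realpow)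
  finally have "real (card X) * ln (real (card S)) \<le> real (card X) * (real L * ln (real C))"
    by (intro mult_left_mono) auto
  also have "\<dots> \<le> (\<epsilon> * real L) * real L"
    using mult_right_mono[OF L(2), of "real L"] by (simp add: mult_ac)
  finally show ?thesis
    using tile cardE ln_card_traj_scalars[OF E n S(1,3) X]
    by (intro exI[of _ "scalar_mat n ` E"]) (auto simp: mult_ac)
qed

text \<open>The tile is the unit group of a finite subfield \<open>R\<close>: it is a finite
  subgroup, and its subset sums never leave \<open>R\<close>.\<close>

lemma small_tile_torsion:
  assumes p: "prime CHAR('k::field)" and inf: "infinite (UNIV :: 'k set)"
    and torsion: "\<And>x :: 'k. x \<noteq> 0 \<Longrightarrow> \<exists>d>0. x ^ d = 1" and n: "n \<ge> 1"
    and X: "finite X" "X \<noteq> {}" "X \<subseteq> carrier_vec n" and \<epsilon>: "\<epsilon> > 0"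
  shows "\<exists>E. left_tile (UT TYPE('k) n) E \<and>
    ln (real (card (alg_trajectory (monoid_vec TYPE('k) n) (natural_action n) E X))) \<le> \<epsilon> * real (card E)"
proof -
  have "(\<lambda>r. real (card X) * ln (real r) / (real r - 1)) \<longlonglongrightarrow> 0"
    by real_asymp
  then have "\<forall>\<^sub>F r in sequentially. real (card X) * ln (real r) / (real r - 1) < \<epsilon>"
    using \<epsilon> by (rule order_tendstoD)
  then obtain N where N: "\<And>r. r \<ge> N \<Longrightarrow> real (card X) * ln (real r) / (real r - 1) < \<epsilon>"
    by (auto simp: eventually_at_top_linorder)
  \<comment> \<open>At least 2 elements keep |R| - 1, the size of the tile, positive.\<close>
  obtain m where m: "m > 0" "card (Frobenius_fixed m :: 'k set) \<ge> max N 2"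
    using large_Frobenius_fixed[OF p inf torsion] by blast
  define R where "R = (Frobenius_fixed m :: 'k set)"
  define E where "E = R - {0}"
  have R: "finite R" "0 \<in> R" "card R \<ge> N" "card R \<ge> 2"
    using finite_Frobenius_fixed[OF p m(1)] Frobenius_fixed_0[OF p] m by (auto simp: R_def)
  have E: "finite E" "0 \<notin> E" using R by (auto simp: E_def)
  have cardE: "real (card E) = real (card R) - 1" using R by (simp add: E_def of_nat_diff)
  have sums: "\<Sum>Y \<in> R" if "Y \<subseteq> E" for Y
    using that unfolding R_def E_def by (intro Frobenius_fixed_sum[OF p]) auto
  interpret G: group "UT TYPE('k) n" by (rule group_UT)
  have one: "scalar_mat n (1 :: 'k) = \<one>\<^bsub>UT TYPE('k) n\<^esub>" by (auto simp: UT_simps)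
  have inv: "inv\<^bsub>UT TYPE('k) n\<^esub> (scalar_mat n c) = scalar_mat n (inverse c)" if "c \<noteq> 0" for c :: 'k
    using that by (intro G.inv_equality) (auto simp: UT_simps(1) scalar_mat_mult one[symmetric] intro!: scalar_mat_in_UT)
  have "subgroup (scalar_mat n ` E) (UT TYPE('k) n)"
  proof (rule G.subgroupI)
    show "scalar_mat n ` E \<subseteq> carrier (UT TYPE('k) n)"
      using scalar_mat_in_UT E(2) by (metis image_subsetI)
    show "scalar_mat n ` E \<noteq> {}"
      using Frobenius_fixed_1[OF p, of m] by (auto simp: E_def R_def)
    show "inv\<^bsub>UT TYPE('k) n\<^esub> M \<in> scalar_mat n ` E" if "M \<in> scalar_mat n ` E" for M
      using that Frobenius_fixed_inverse[OF p] by (auto simp: E_def R_def inv)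
    show "M \<otimes>\<^bsub>UT TYPE('k) n\<^esub> N \<in> scalar_mat n ` E"
      if "M \<in> scalar_mat n ` E" "N \<in> scalar_mat n ` E" for M N
      using that Frobenius_fixed_mult[OF p] by (auto simp: E_def R_def UT_simps scalar_mat_mult)
  qed
  then have tile: "left_tile (UT TYPE('k) n) (scalar_mat n ` E)"
    using E by (intro G.left_tile_subgroup) auto
  have "inj_on (scalar_mat n) E"
    using scalar_mat_inj[OF n] by (auto simp: inj_on_def)
  then have card_image: "card (scalar_mat n ` E) = card E" by (rule card_image)
  have "real (card X) * ln (real (card R)) \<le> \<epsilon> * real (card E)"
    using N[OF R(3)] R(4) unfolding cardE by (simp add: field_simps)
  then show ?thesis
    using tile card_image ln_card_traj_scalars[OF E n R(1) sums X]
    by (intro exI[of _ "scalar_mat n ` E"]) auto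
qed

theorem corollary5p18:
  fixes n :: nat
  assumes "infinite (UNIV :: 'k::field set)" and "n \<ge> 1"
  shows "h_alg (upper_triangular_group TYPE('k) n) (monoid_vec TYPE('k) n) (natural_action n) = 0"
proof -
  interpret automorphism_action "UT TYPE('k) n" "monoid_vec TYPE('k) n" "natural_action n"
    by (rule automorphism_action_UT)
  have "H_alg (UT TYPE('k) n) (monoid_vec TYPE('k) n) (natural_action n) X = 0"
    if X: "finite X" "X \<noteq> {}" "X \<subseteq> carrier_vec n" for X
  proof (rule H_alg_eq_zero[OF has_Folner_sets_UT])
    fix \<epsilon> :: real assume "\<epsilon> > 0"
    from assms(1) show "\<exists>E. left_tile (UT TYPE('k) n) E \<and> ln (real (card (traj E X))) \<le> \<epsilon> * real (card E)"
    proof (cases rule: field_cases)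
      case (box a b)
      then show ?thesis using assms(2) X \<open>\<epsilon> > 0\<close> by (rule small_tile_box)
    next
      case torsion
      then show ?thesis
        using small_tile_torsion[OF torsion(1) assms(1) torsion(2) assms(2) X \<open>\<epsilon> > 0\<close>] by blast
    qed
  qed (use X in \<open>auto simp: monoid_vec_simps\<close>)
  then have "h_alg (UT TYPE('k) n) (monoid_vec TYPE('k) n) (natural_action n) =
      (SUP X \<in> {X. X \<noteq> {} \<and> finite X \<and> X \<subseteq> carrier (monoid_vec TYPE('k) n)}. 0)"
    unfolding h_alg_def by (intro SUP_cong) (auto simp: monoid_vec_simps)
  also have "\<dots> = 0"
  \<comment> \<open>In \<open>ereal\<close> the supremum over an empty family is minus infinity, so
    a witness for the index set is required.\<close>
  proof (rule SUP_const)
    have "{0\<^sub>v n} \<in> {X. X \<noteq> {} \<and> finite X \<and> X \<subseteq> carrier (monoid_vec TYPE('k) n)}"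
      by (simp add: monoid_vec_simps)
    then show "{X. X \<noteq> {} \<and> finite X \<and> X \<subseteq> carrier (monoid_vec TYPE('k) n)} \<noteq> {}" by blast
  qed
  finally show ?thesis .
qed

end
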